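(* Let $n$ be a positive integer and $p\in(0,1)$. Let $\{I_{i,j}:1\le i<j\le n\}$ be independent Bernoulli$(p)$ random variables (edge indicators of a Bernoulli random graph $G(n,p)$), and let $$\mathbf{T}_n(t)=\frac{\lfloor nt\rfloor-2}{n^2}\sum_{1\le i<j\le\lfloor nt\rfloor}I_{i,j},\qquad \mathbf{Y}_n(t)=\mathbf{T}_n(t)-\mathbb{E}\mathbf{T}_n(t),\qquad t\in[0,1].$$ Let $Z_{ii}=0$ for all $i\in\{1,\dots,n\}$ and let $\{Z_{ij}:i,j\in\{1,\dots,n\},i\ne j\}$ be jointly centred Gaussian with $$\mathbb{E}Z_{ij}Z_{kl}=\begin{cases}\frac{p(1-p)}{2n^4},& i=k,\ j=l,\ i\neq j,\\ 0,&\text{otherwise,}\end{cases}$$ and let $$\mathbf{D}_n(t)=(\lfloor nt\rfloor-2)\sum_{i,j=1}^{\lfloor nt\rfloor}Z_{ij},\qquad t\in[0,1].$$ Then, for any $g\in M$, $$|\mathbb{E}g(\mathbf{Y}_n)-\mathbb{E}g(\mathbf{D}_n)|\le\frac18\|g\|_Mn^{-1}.$$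
   Context: $D=D([0,1],\mathbb{R})$ is the Skorokhod space of càdlàg functions $[0,1]\to\mathbb{R}$, with $\|w\|=\sup_{t\in[0,1]}|w(t)|$. Fréchet derivatives are with respect to this norm, and a $k$-linear form $B$ on $D$ has norm $\|B\|=\sup_{\{h:\|h\|=1\}}|B[h,\dots,h]|$. $M$ is the set of continuous functions $f:D\to\mathbb{R}$ with $\sup_{w\in D}\frac{|f(w)|}{1+\|w\|^3}<\infty$ that are twice Fréchet differentiable and satisfy $\|D^2f(w+h)-D^2f(w)\|\le k_f\|h\|$ for some constant $k_f$, uniformly in $w,h\in D$. For $f\in M$, $$\|f\|_M=\sup_{w}\frac{|f(w)|}{1+\|w\|^3}+\sup_{w}\frac{\|Df(w)\|}{1+\|w\|^2}+\sup_{w}\frac{\|D^2f(w)\|}{1+\|w\|}+\sup_{w,h}\frac{\|D^2f(w+h)-D^2f(w)\|}{\|h\|},$$ which is finite for every $f\in M$. *)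

theory Defs
  imports "HOL-Probability.Probability"
begin

section \<open>The Skorokhod space with the supremum norm\<close>

definition cadlag01 :: "(real \<Rightarrow> real) \<Rightarrow> bool" where
  "cadlag01 w \<longleftrightarrow>
     (\<forall>t. 0 \<le> t \<and> t < 1 \<longrightarrow> (w \<longlongrightarrow> w t) (at_right t)) \<and>
     (\<forall>t. 0 < t \<and> t \<le> 1 \<longrightarrow> (\<exists>l. (w \<longlongrightarrow> l) (at_left t)))"

text \<open>A function on the unit interval is represented by its extension by zero to the real line,
  so that equality of representatives is equality on the unit interval.\<close>

typedef skorokhod = "{w :: real \<Rightarrow> real. cadlag01 w \<and> (\<forall>t. t \<notin> {0..1} \<longrightarrow> w t = 0)}"
  morphisms path Abs_skorokhod
  by (rule exI[of _ "\<lambda>_. 0"]) (auto simp: cadlag01_def)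

definition to_skorokhod :: "(real \<Rightarrow> real) \<Rightarrow> skorokhod" where
  "to_skorokhod w = Abs_skorokhod (\<lambda>t. if t \<in> {0..1} then w t else 0)"

lemma path_cadlag: "cadlag01 (path w)"
  using path[of w] by simp

lemma path_outside: "t \<notin> {0..1} \<Longrightarrow> path w t = 0"
  using path[of w] by simp

lemma cadlag01_cong:
  assumes "cadlag01 v" and eq: "\<And>t. t \<in> {0..1} \<Longrightarrow> w t = v t"
  shows "cadlag01 w"
  unfolding cadlag01_def
proof (intro conjI allI impI)
  fix t :: real assume t: "0 \<le> t \<and> t < 1"
  have ev: "\<forall>\<^sub>F s in at_right t. w s = v s"
    using eventually_at_right_real[of t 1] t by (auto elim!: eventually_mono simp: eq)
  have "(v \<longlongrightarrow> v t) (at_right t)" using assms(1) t by (auto simp: cadlag01_def)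
  moreover have "w t = v t" using t by (intro eq) auto
  ultimately show "(w \<longlongrightarrow> w t) (at_right t)" using tendsto_cong[OF ev] by simp
next
  fix t :: real assume t: "0 < t \<and> t \<le> 1"
  have ev: "\<forall>\<^sub>F s in at_left t. w s = v s"
    using eventually_at_left_real[of 0 t] t by (auto elim!: eventually_mono simp: eq)
  obtain l where "(v \<longlongrightarrow> l) (at_left t)" using assms(1) t by (auto simp: cadlag01_def)
  then show "\<exists>l. (w \<longlongrightarrow> l) (at_left t)" using tendsto_cong[OF ev] by auto
qed

lemma path_to_skorokhod:
  assumes "cadlag01 w"
  shows "path (to_skorokhod w) = (\<lambda>t. if t \<in> {0..1} then w t else 0)"
proof -
  have "cadlag01 (\<lambda>t. if t \<in> {0..1} then w t else 0)"
    by (rule cadlag01_cong[OF assms]) simp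
  then show ?thesis unfolding to_skorokhod_def by (subst Abs_skorokhod_inverse) auto
qed

lemma cadlag01_bounded:
  assumes "cadlag01 w"
  shows "\<exists>C. \<forall>t\<in>{0..1}. \<bar>w t\<bar> \<le> C"
proof -
  define P where "P = (\<lambda>a b :: real. \<exists>C. \<forall>t. a \<le> t \<and> t \<le> b \<and> 0 \<le> t \<and> t \<le> 1 \<longrightarrow> \<bar>w t\<bar> \<le> C)"
  have "P 0 1"
  proof (rule Bolzano)
    fix a b c :: real assume "P a b" "P b c"
    then obtain C D
      where C: "\<And>t. a \<le> t \<and> t \<le> b \<and> 0 \<le> t \<and> t \<le> 1 \<Longrightarrow> \<bar>w t\<bar> \<le> C"
        and D: "\<And>t. b \<le> t \<and> t \<le> c \<and> 0 \<le> t \<and> t \<le> 1 \<Longrightarrow> \<bar>w t\<bar> \<le> D"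
      unfolding P_def by blast
    have "\<bar>w t\<bar> \<le> max C D" if "a \<le> t \<and> t \<le> c \<and> 0 \<le> t \<and> t \<le> 1" for t
      using C[of t] D[of t] that by (cases "t \<le> b") auto
    then show "P a c" unfolding P_def by blast
  next
    fix x :: real assume x: "0 \<le> x" "x \<le> 1"
    have R: "\<exists>d>0. \<exists>C. \<forall>t. x < t \<and> t < x + d \<and> t \<le> 1 \<longrightarrow> \<bar>w t\<bar> \<le> C"
    proof (cases "x < 1")
      case True
      then have "(w \<longlongrightarrow> w x) (at_right x)" using assms x by (auto simp: cadlag01_def)
      then have "\<forall>\<^sub>F t in at_right x. dist (w t) (w x) < 1" by (rule tendstoD) simp
      then obtain b where "b > x" "\<And>t. x < t \<Longrightarrow> t < b \<Longrightarrow> dist (w t) (w x) < 1"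
        unfolding eventually_at_right_field by blast
      then show ?thesis
        by (intro exI[of _ "b - x"] conjI exI[of _ "\<bar>w x\<bar> + 1"]) (force simp: dist_real_def)+
    next
      case False
      then show ?thesis by (intro exI[of _ 1]) auto
    qed
    have L: "\<exists>d>0. \<exists>C. \<forall>t. x - d < t \<and> t < x \<and> 0 \<le> t \<longrightarrow> \<bar>w t\<bar> \<le> C"
    proof (cases "x > 0")
      case True
      then obtain l where "(w \<longlongrightarrow> l) (at_left x)" using assms x by (auto simp: cadlag01_def)
      then have "\<forall>\<^sub>F t in at_left x. dist (w t) l < 1" by (rule tendstoD) simp
      then obtain b where "b < x" "\<And>t. b < t \<Longrightarrow> t < x \<Longrightarrow> dist (w t) l < 1"
        unfolding eventually_at_left_field by blast
      then show ?thesis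
        by (intro exI[of _ "x - b"] conjI exI[of _ "\<bar>l\<bar> + 1"]) (force simp: dist_real_def)+
    next
      case False
      then show ?thesis by (intro exI[of _ 1]) auto
    qed
    obtain d C where d: "d > 0" "\<And>t. x < t \<and> t < x + d \<and> t \<le> 1 \<Longrightarrow> \<bar>w t\<bar> \<le> C"
      using R by blast
    obtain e D where e: "e > 0" "\<And>t. x - e < t \<and> t < x \<and> 0 \<le> t \<Longrightarrow> \<bar>w t\<bar> \<le> D"
      using L by blast
    have "P a b" if ab: "a \<le> x \<and> x \<le> b \<and> b - a < min d e" for a b
      unfolding P_def
    proof (intro exI[of _ "max \<bar>w x\<bar> (max C D)"] allI impI)
      fix t assume t: "a \<le> t \<and> t \<le> b \<and> 0 \<le> t \<and> t \<le> 1"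
      consider "t < x" | "t = x" | "t > x" by linarith
      then show "\<bar>w t\<bar> \<le> max \<bar>w x\<bar> (max C D)"
      proof cases
        case 1 with ab t have "\<bar>w t\<bar> \<le> D" by (intro e(2)) auto
        then show ?thesis by auto
      next
        case 3 with ab t have "\<bar>w t\<bar> \<le> C" by (intro d(2)) auto
        then show ?thesis by auto
      qed auto
    qed
    then show "\<exists>d>0. \<forall>a b. a \<le> x \<and> x \<le> b \<and> b - a < d \<longrightarrow> P a b"
      using d(1) e(1) by (intro exI[of _ "min d e"]) auto
  qed simp
  then obtain C where "\<forall>t. 0 \<le> t \<and> t \<le> 1 \<longrightarrow> \<bar>w t\<bar> \<le> C" unfolding P_def by auto
  then show ?thesis by (intro exI[of _ C]) auto
qed

lemma cadlag01_add: "cadlag01 v \<Longrightarrow> cadlag01 w \<Longrightarrow> cadlag01 (\<lambda>t. v t + w t)"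
  unfolding cadlag01_def by (blast intro: tendsto_add)

lemma cadlag01_cmult: "cadlag01 w \<Longrightarrow> cadlag01 (\<lambda>t. c * w t)"
  unfolding cadlag01_def by (blast intro: tendsto_mult_left)

lemma cadlag01_const: "cadlag01 (\<lambda>_. c)"
  unfolding cadlag01_def by auto

lemma cadlag01_diff: "cadlag01 v \<Longrightarrow> cadlag01 w \<Longrightarrow> cadlag01 (\<lambda>t. v t - w t)"
  unfolding cadlag01_def by (blast intro: tendsto_diff)

lemma skorokhod_eqI: "(\<And>t. t \<in> {0..1} \<Longrightarrow> path v t = path w t) \<Longrightarrow> v = w"
  by (metis path_outside path_inject ext)

instantiation skorokhod :: real_vector
begin

definition zero_skorokhod :: skorokhod where "0 = to_skorokhod (\<lambda>_. 0)"
definition plus_skorokhod :: "skorokhod \<Rightarrow> skorokhod \<Rightarrow> skorokhod" where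
  "v + w = to_skorokhod (\<lambda>t. path v t + path w t)"
definition minus_skorokhod :: "skorokhod \<Rightarrow> skorokhod \<Rightarrow> skorokhod" where
  "v - w = to_skorokhod (\<lambda>t. path v t - path w t)"
definition uminus_skorokhod :: "skorokhod \<Rightarrow> skorokhod" where
  "- w = to_skorokhod (\<lambda>t. - path w t)"
definition scaleR_skorokhod :: "real \<Rightarrow> skorokhod \<Rightarrow> skorokhod" where
  "c *\<^sub>R w = to_skorokhod (\<lambda>t. c * path w t)"

lemma path_zero: "path 0 t = 0"
  by (simp add: zero_skorokhod_def path_to_skorokhod cadlag01_const)

lemma path_add: "path (v + w) t = path v t + path w t"
  by (simp add: plus_skorokhod_def path_to_skorokhod cadlag01_add path_cadlag path_outside)

lemma path_diff: "path (v - w) t = path v t - path w t"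
  by (simp add: minus_skorokhod_def path_to_skorokhod cadlag01_diff path_cadlag path_outside)

lemma path_uminus: "path (- w) t = - path w t"
  using cadlag01_cmult[OF path_cadlag, of "-1" w]
  by (simp add: uminus_skorokhod_def path_to_skorokhod path_outside)

lemma path_scaleR: "path (c *\<^sub>R w) t = c * path w t"
  by (simp add: scaleR_skorokhod_def path_to_skorokhod cadlag01_cmult path_cadlag path_outside)

instance
  by standard
    (auto intro!: skorokhod_eqI
      simp: path_zero path_add path_diff path_uminus path_scaleR algebra_simps)

end

lemma bdd_above_path: "bdd_above ((\<lambda>t. \<bar>path w t\<bar>) ` {0..1})"
  using cadlag01_bounded[OF path_cadlag, of w] unfolding bdd_above_def by auto

instantiation skorokhod :: real_normed_vector
begin

definition norm_skorokhod :: "skorokhod \<Rightarrow> real" where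
  "norm w = (SUP t\<in>{0..1}. \<bar>path w t\<bar>)"
definition dist_skorokhod :: "skorokhod \<Rightarrow> skorokhod \<Rightarrow> real" where
  "dist_skorokhod v w = norm (v - w)"
definition sgn_skorokhod :: "skorokhod \<Rightarrow> skorokhod" where
  "sgn_skorokhod w = inverse (norm w) *\<^sub>R w"
definition uniformity_skorokhod :: "(skorokhod \<times> skorokhod) filter" where
  "uniformity_skorokhod = (INF e\<in>{0 <..}. principal {(x, y). dist x y < e})"
definition open_skorokhod :: "skorokhod set \<Rightarrow> bool" where
  "open_skorokhod U = (\<forall>x\<in>U. \<forall>\<^sub>F (x', y) in uniformity. x' = x \<longrightarrow> y \<in> U)"

lemma abs_path_le_norm: "t \<in> {0..1} \<Longrightarrow> \<bar>path w t\<bar> \<le> norm w"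
  unfolding norm_skorokhod_def by (rule cSUP_upper[OF _ bdd_above_path])

lemma norm_skorokhod_le: "(\<And>t. t \<in> {0..1} \<Longrightarrow> \<bar>path w t\<bar> \<le> C) \<Longrightarrow> norm w \<le> C"
  unfolding norm_skorokhod_def by (rule cSUP_least) auto

instance
proof
  fix v w :: skorokhod and c :: real
  have nonneg: "0 \<le> norm w" for w :: skorokhod
    using abs_path_le_norm[of 0 w] by simp
  show "norm w = 0 \<longleftrightarrow> w = 0"
  proof
    assume "norm w = 0"
    then show "w = 0" using abs_path_le_norm[of _ w] by (intro skorokhod_eqI) (auto simp: path_zero)
  next
    assume "w = 0"
    then have "norm w \<le> 0" by (intro norm_skorokhod_le) (simp add: path_zero)
    with nonneg[of w] show "norm w = 0" by simp
  qed
  show "norm (v + w) \<le> norm v + norm w"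
  proof (rule norm_skorokhod_le)
    fix t :: real assume "t \<in> {0..1}"
    then show "\<bar>path (v + w) t\<bar> \<le> norm v + norm w"
      using abs_path_le_norm[of t v] abs_path_le_norm[of t w] by (simp add: path_add)
  qed
  have le: "norm (c *\<^sub>R w) \<le> \<bar>c\<bar> * norm w" for c and w :: skorokhod
    by (rule norm_skorokhod_le)
      (simp add: path_scaleR abs_mult mult_left_mono abs_path_le_norm)
  show "norm (c *\<^sub>R w) = \<bar>c\<bar> * norm w"
  proof (cases "c = 0")
    case True
    then show ?thesis using le[of c w] nonneg[of "c *\<^sub>R w"] by simp
  next
    case False
    have "norm w = norm (inverse c *\<^sub>R (c *\<^sub>R w))" using False by simp
    also have "\<dots> \<le> \<bar>inverse c\<bar> * norm (c *\<^sub>R w)" by (rule le)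
    finally have "\<bar>c\<bar> * norm w \<le> norm (c *\<^sub>R w)" using False by (simp add: field_simps)
    with le[of c w] show ?thesis by simp
  qed
qed (simp_all add: dist_skorokhod_def sgn_skorokhod_def uniformity_skorokhod_def
       open_skorokhod_def)

end


section \<open>Test functions\<close>

text \<open>These are derivatives in the usual sense only at points of differentiability; elsewhere
  their values are unspecified.\<close>

definition fderiv ::
  "('a::real_normed_vector \<Rightarrow> 'b::real_normed_vector) \<Rightarrow> 'a \<Rightarrow> ('a \<Rightarrow>\<^sub>L 'b)" where
  "fderiv f w = Blinfun (frechet_derivative f (at w))"

definition fderiv2 ::
  "('a::real_normed_vector \<Rightarrow> 'b::real_normed_vector) \<Rightarrow> 'a \<Rightarrow> ('a \<Rightarrow>\<^sub>L 'a \<Rightarrow>\<^sub>L 'b)" where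
  "fderiv2 f = fderiv (fderiv f)"

lemma has_derivative_fderiv:
  "f differentiable (at w) \<Longrightarrow> (f has_derivative blinfun_apply (fderiv f w)) (at w)"
  unfolding fderiv_def
  by (metis bounded_linear_Blinfun_apply frechet_derivative_works has_derivative_bounded_linear)

text \<open>The norm of a \<open>k\<close>-linear form \<open>B\<close> is \<open>form_norm (\<lambda>h. B[h,\<dots>,h])\<close>: it depends only on the
  diagonal of \<open>B\<close>, and for \<open>k = 2\<close> it is not the operator norm.\<close>

definition form_norm :: "('a::real_normed_vector \<Rightarrow> real) \<Rightarrow> real" where
  "form_norm q = (SUP h\<in>{h. norm h = 1}. \<bar>q h\<bar>)"

text \<open>Continuity is with respect to the supremum norm.\<close>

definition test_functions :: "(skorokhod \<Rightarrow> real) set" where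
  "test_functions = {f.
     continuous_on UNIV f \<and>
     bdd_above (range (\<lambda>w. \<bar>f w\<bar> / (1 + norm w ^ 3))) \<and>
     (\<forall>w. f differentiable (at w)) \<and>
     (\<forall>w. fderiv f differentiable (at w)) \<and>
     (\<exists>k. \<forall>w h. form_norm (\<lambda>u. (fderiv2 f (w + h) - fderiv2 f w) u u) \<le> k * norm h)}"

text \<open>All four suprema are taken in the reals; for members of \<open>test_functions\<close> the sets are
  bounded, so that these are genuine suprema.\<close>

definition norm_M :: "(skorokhod \<Rightarrow> real) \<Rightarrow> real" where
  "norm_M f =
     (SUP w. \<bar>f w\<bar> / (1 + norm w ^ 3)) +
     (SUP w. form_norm (\<lambda>u. fderiv f w u) / (1 + norm w ^ 2)) +
     (SUP w. form_norm (\<lambda>u. fderiv2 f w u u) / (1 + norm w)) +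
     (SUP (w, h)\<in>UNIV \<times> {h. h \<noteq> 0}.
        form_norm (\<lambda>u. (fderiv2 f (w + h) - fderiv2 f w) u u) / norm h)"


section \<open>The processes\<close>

definition edges :: "nat \<Rightarrow> (nat \<times> nat) set" where
  "edges m = {(i, j). 1 \<le> i \<and> i < j \<and> j \<le> m}"

definition bernoulli_rv :: "'a measure \<Rightarrow> real \<Rightarrow> ('a \<Rightarrow> real) \<Rightarrow> bool" where
  "bernoulli_rv P p X \<longleftrightarrow>
     X \<in> borel_measurable P \<and> distr P borel X = distr (bernoulli_pmf p) borel of_bool"

text \<open>The centred Gaussian law with standard deviation \<open>s \<ge> 0\<close>, degenerate if \<open>s = 0\<close>.\<close>

definition centred_gaussian :: "real \<Rightarrow> real measure" where
  "centred_gaussian s =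
     (if s = 0 then return borel 0 else density lborel (\<lambda>x. ennreal (normal_density 0 s x)))"

definition jointly_centred_gaussian ::
  "'a measure \<Rightarrow> 'i set \<Rightarrow> ('i \<Rightarrow> 'a \<Rightarrow> real) \<Rightarrow> bool" where
  "jointly_centred_gaussian P J Z \<longleftrightarrow>
     (\<forall>k\<in>J. Z k \<in> borel_measurable P) \<and>
     (\<forall>a. \<exists>s\<ge>0. distr P borel (\<lambda>\<omega>. \<Sum>k\<in>J. a k * Z k \<omega>) = centred_gaussian s)"

definition T_proc :: "nat \<Rightarrow> (nat \<times> nat \<Rightarrow> 'a \<Rightarrow> real) \<Rightarrow> real \<Rightarrow> 'a \<Rightarrow> real" where
  "T_proc n I t \<omega> =
     (of_int \<lfloor>real n * t\<rfloor> - 2) / real n ^ 2 * (\<Sum>(i, j)\<in>edges (nat \<lfloor>real n * t\<rfloor>). I (i, j) \<omega>)"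

definition Y_proc ::
  "'a measure \<Rightarrow> nat \<Rightarrow> (nat \<times> nat \<Rightarrow> 'a \<Rightarrow> real) \<Rightarrow> 'a \<Rightarrow> skorokhod" where
  "Y_proc P n I \<omega> =
     to_skorokhod (\<lambda>t. T_proc n I t \<omega> - prob_space.expectation P (T_proc n I t))"

definition D_proc :: "nat \<Rightarrow> (nat \<times> nat \<Rightarrow> 'a \<Rightarrow> real) \<Rightarrow> 'a \<Rightarrow> skorokhod" where
  "D_proc n Z \<omega> =
     to_skorokhod (\<lambda>t. (of_int \<lfloor>real n * t\<rfloor> - 2) *
       (\<Sum>i = 1..nat \<lfloor>real n * t\<rfloor>. \<Sum>j = 1..nat \<lfloor>real n * t\<rfloor>. Z (i, j) \<omega>))"

lemma cadlag01_floor: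
  fixes F :: "int \<Rightarrow> real"
  shows "cadlag01 (\<lambda>t. F \<lfloor>real n * t\<rfloor>)"
proof (cases "n = 0")
  case True
  then show ?thesis by (simp add: cadlag01_const)
next
  case False
  then have n: "real n > 0" by simp
  show ?thesis
    unfolding cadlag01_def
  proof (intro conjI allI impI)
    fix t :: real
    define b where "b = (of_int \<lfloor>real n * t\<rfloor> + 1) / real n"
    have "t < b" using n unfolding b_def by (simp add: field_simps) linarith
    then have "\<forall>\<^sub>F s in at_right t. s \<in> {t<..<b}" by (rule eventually_at_right_real)
    then have "\<forall>\<^sub>F s in at_right t. F \<lfloor>real n * s\<rfloor> = F \<lfloor>real n * t\<rfloor>"
    proof (rule eventually_mono)
      fix s assume s: "s \<in> {t<..<b}"
      have "real n * t < real n * s" "real n * s < of_int \<lfloor>real n * t\<rfloor> + 1"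
        using s n by (auto simp: b_def field_simps)
      then have "\<lfloor>real n * s\<rfloor> = \<lfloor>real n * t\<rfloor>" by linarith
      then show "F \<lfloor>real n * s\<rfloor> = F \<lfloor>real n * t\<rfloor>" by simp
    qed
    then show "((\<lambda>t. F \<lfloor>real n * t\<rfloor>) \<longlongrightarrow> F \<lfloor>real n * t\<rfloor>) (at_right t)"
      by (rule tendsto_eventually)
  next
    fix t :: real
    define b where "b = (of_int \<lceil>real n * t\<rceil> - 1) / real n"
    have "b < t" using n unfolding b_def by (simp add: field_simps) linarith
    then have "\<forall>\<^sub>F s in at_left t. s \<in> {b<..<t}" by (rule eventually_at_left_real)
    then have "\<forall>\<^sub>F s in at_left t. F \<lfloor>real n * s\<rfloor> = F (\<lceil>real n * t\<rceil> - 1)"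
    proof (rule eventually_mono)
      fix s assume s: "s \<in> {b<..<t}"
      have "real n * s < real n * t" "of_int \<lceil>real n * t\<rceil> - 1 < real n * s"
        using s n by (auto simp: b_def field_simps)
      then have "\<lfloor>real n * s\<rfloor> = \<lceil>real n * t\<rceil> - 1" by linarith
      then show "F \<lfloor>real n * s\<rfloor> = F (\<lceil>real n * t\<rceil> - 1)" by simp
    qed
    then show "\<exists>l. ((\<lambda>t. F \<lfloor>real n * t\<rfloor>) \<longlongrightarrow> l) (at_left t)"
      by (blast intro: tendsto_eventually)
  qed
qed

lemma path_Y_proc:
  assumes "t \<in> {0..1}"
  shows "path (Y_proc P n I \<omega>) t = T_proc n I t \<omega> - prob_space.expectation P (T_proc n I t)"
proof -
  define F where "F = (\<lambda>m \<omega>. (of_int m - 2) / real n ^ 2 * (\<Sum>(i, j)\<in>edges (nat m). I (i, j) \<omega>))"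
  have T: "T_proc n I t = F \<lfloor>real n * t\<rfloor>" for t
    by (simp add: fun_eq_iff T_proc_def F_def)
  have "cadlag01 (\<lambda>t. F \<lfloor>real n * t\<rfloor> \<omega> - prob_space.expectation P (F \<lfloor>real n * t\<rfloor>))"
    by (rule cadlag01_floor)
  then show ?thesis using assms by (simp add: Y_proc_def T path_to_skorokhod)
qed

lemma path_D_proc:
  assumes "t \<in> {0..1}"
  shows "path (D_proc n Z \<omega>) t = (of_int \<lfloor>real n * t\<rfloor> - 2) *
    (\<Sum>i = 1..nat \<lfloor>real n * t\<rfloor>. \<Sum>j = 1..nat \<lfloor>real n * t\<rfloor>. Z (i, j) \<omega>)"
proof -
  have "cadlag01 (\<lambda>t. (of_int \<lfloor>real n * t\<rfloor> - 2) *
      (\<Sum>i = 1..nat \<lfloor>real n * t\<rfloor>. \<Sum>j = 1..nat \<lfloor>real n * t\<rfloor>. Z (i, j) \<omega>))"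
    by (rule cadlag01_floor[where F = "\<lambda>m. (of_int m - 2) * (\<Sum>i = 1..nat m. \<Sum>j = 1..nat m. Z (i, j) \<omega>)"])
  then show ?thesis using assms by (simp add: D_proc_def path_to_skorokhod)
qed

end

theory Submission
  imports Defs
begin

text \<open>Lindeberg's replacement argument. Let \<open>\<phi>\<^sub>e\<close>, for an edge \<open>e = (i, j)\<close>, be the path
  \<open>t \<mapsto> (\<lfloor>nt\<rfloor> - 2) / n\<^sup>2\<close> switched on at \<open>\<lfloor>nt\<rfloor> \<ge> j\<close>; since \<open>j \<ge> 2\<close> its norm is at most
  \<open>1 / n\<close>. Then \<open>Y\<^sub>n = \<Sum>\<^sub>e (I\<^sub>e - p) \<phi>\<^sub>e\<close> and \<open>D\<^sub>n = \<Sum>\<^sub>e n\<^sup>2 (Z\<^sub>i\<^sub>j + Z\<^sub>j\<^sub>i) \<phi>\<^sub>e\<close>, where both families of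
  coefficients are independent and centred with variance \<open>p (1 - p)\<close>. Exchanging one coefficient at
  a time, a second-order Taylor expansion leaves an error of at most
  \<open>norm_M g / 2 * norm \<phi>\<^sub>e ^ 3\<close> times the sum of the third absolute moments, each of which is at
  most \<open>1 / 4\<close>. There are at most \<open>n\<^sup>2 / 2\<close> edges, so the total error is at most \<open>norm_M g / (8 n)\<close>.\<close>

section \<open>Taylor expansion of test functions\<close>

text \<open>Two obstacles shape the proof. With the supremum norm the path space is not separable,
  so the processes are never handled as random elements of it. Both are finite combinations of
  deterministic paths, so each expectation becomes an integral against the law of a finite real
  vector. The exchange then takes place in product measures, and the two processes may live on
  unrelated sample spaces \<open>P\<close> and \<open>Q\<close>. Secondly, joint Gaussianity is
  given only through the laws of linear combinations, so the independence of the Gaussian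
  coefficients has to be derived. Orthogonality makes their characteristic functions factor, and a
  separate argument turns this into a product law using uniqueness of characteristic functions on
  the real line alone. The exponent three enters twice: equality of two moments leaves a cubic
  remainder, and cubic growth of the test function makes finite third moments enough for
  integrability. Expansions are taken along lines only, because the norms of the forms control
  diagonal values \<open>B u u\<close> and nothing else.\<close>

lemma has_vector_derivative_line:
  fixes f :: "'a::real_normed_vector \<Rightarrow> 'b::real_normed_vector"
  assumes "f differentiable (at (w + s *\<^sub>R u))"
  shows "((\<lambda>s. f (w + s *\<^sub>R u)) has_vector_derivative fderiv f (w + s *\<^sub>R u) u) (at s)"
proof -
  have "((\<lambda>s. w + s *\<^sub>R u) has_derivative (\<lambda>r. r *\<^sub>R u)) (at s)"
    by (auto intro!: derivative_eq_intros)
  from has_derivative_compose[OF this has_derivative_fderiv[OF assms]]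
  show ?thesis
    by (simp add: has_vector_derivative_def blinfun.scaleR_right)
qed

text \<open>Everything is restricted to the line through \<open>w\<close> in direction
  \<open>u\<close>. The Lagrange remainder has the second derivative at an intermediate point
  \<open>t\<close>; comparing it with the one at \<open>w\<close> costs
  \<open>K * \<bar>t\<bar> * norm u ^ 3\<close>, with \<bar>t\<bar> \<le> \<bar>y\<bar>. The factor
  1/2 is that of the Lagrange form.\<close>

lemma taylor_second_order:
  fixes f :: "'a::real_normed_vector \<Rightarrow> real"
  assumes d1: "\<And>w. f differentiable (at w)"
    and d2: "\<And>w. fderiv f differentiable (at w)"
    and lip: "\<And>w h u. \<bar>(fderiv2 f (w + h) - fderiv2 f w) u u\<bar> \<le> K * norm h * norm u ^ 2"
  shows "\<bar>f (w + y *\<^sub>R u) - (f w + y * fderiv f w u + y ^ 2 * (fderiv2 f w u u / 2))\<bar>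
    \<le> K / 2 * norm u ^ 3 * \<bar>y\<bar> ^ 3"
proof -
  define D where "D = (\<lambda>(m::nat) s. if m = 0 then f (w + s *\<^sub>R u)
    else if m = 1 then fderiv f (w + s *\<^sub>R u) u else fderiv2 f (w + s *\<^sub>R u) u u)"
  have 1: "((\<lambda>s. f (w + s *\<^sub>R u)) has_real_derivative fderiv f (w + s *\<^sub>R u) u) (at s)" for s
    using has_vector_derivative_line[OF d1] by (simp add: has_real_derivative_iff_has_vector_derivative)
  have 2: "((\<lambda>s. fderiv f (w + s *\<^sub>R u) u) has_real_derivative fderiv2 f (w + s *\<^sub>R u) u u) (at s)"
    for s
    using bounded_linear.has_vector_derivative[OF blinfun.bounded_linear_left has_vector_derivative_line[OF d2]]
    by (simp add: has_real_derivative_iff_has_vector_derivative fderiv2_def)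
  have "\<exists>t. \<bar>t\<bar> \<le> \<bar>y\<bar> \<and> f (w + y *\<^sub>R u) = (\<Sum>m<2. D m 0 / fact m * y ^ m) + D 2 t / fact 2 * y ^ 2"
  proof (rule Maclaurin_bi_le)
    show "\<forall>m t. m < 2 \<and> \<bar>t\<bar> \<le> \<bar>y\<bar> \<longrightarrow> (D m has_real_derivative D (Suc m) t) (at t)"
      using 1 2 by (auto simp: D_def less_2_cases_iff)
  qed (simp add: D_def)
  then obtain t where t: "\<bar>t\<bar> \<le> \<bar>y\<bar>"
    and eq: "f (w + y *\<^sub>R u) = f w + fderiv f w u * y + fderiv2 f (w + t *\<^sub>R u) u u / 2 * y ^ 2"
    by (auto simp: D_def numeral_2_eq_2)
  \<comment> \<open>The sign of \<open>K\<close> is not assumed; the Lipschitz bound with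
    \<open>h = u\<close> gives the sign of the product that is needed.\<close>
  have K: "0 \<le> K * norm u * norm u ^ 2"
    using lip[of w u u] by (rule order_trans[OF abs_ge_zero])
  have "f (w + y *\<^sub>R u) - (f w + y * fderiv f w u + y ^ 2 * (fderiv2 f w u u / 2)) =
    y ^ 2 / 2 * (fderiv2 f (w + t *\<^sub>R u) - fderiv2 f w) u u"
    by (simp add: eq blinfun.diff_left field_simps)
  then have "\<bar>f (w + y *\<^sub>R u) - (f w + y * fderiv f w u + y ^ 2 * (fderiv2 f w u u / 2))\<bar> =
    y ^ 2 / 2 * \<bar>(fderiv2 f (w + t *\<^sub>R u) - fderiv2 f w) u u\<bar>"
    by (simp only: abs_mult abs_divide abs_power2 abs_numeral)
  also have "\<dots> \<le> y ^ 2 / 2 * (K * norm (t *\<^sub>R u) * norm u ^ 2)"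
    by (intro mult_left_mono lip) auto
  also have "\<dots> = y ^ 2 / 2 * (\<bar>t\<bar> * (K * norm u * norm u ^ 2))"
    by (simp add: mult_ac)
  also have "\<dots> \<le> y ^ 2 / 2 * (\<bar>y\<bar> * (K * norm u * norm u ^ 2))"
    using t K by (intro mult_left_mono mult_right_mono) auto
  also have "\<dots> = K / 2 * norm u ^ 3 * \<bar>y\<bar> ^ 3"
    by (simp add: power3_eq_cube power2_eq_square mult_ac)
  finally show ?thesis .
qed

text \<open>A supremum over the unit sphere is meaningful in the reals only if the sphere is
  nonempty; the constant path 1 lies on it.\<close>

lemma exists_unit_skorokhod: "\<exists>u :: skorokhod. norm u = 1"
proof
  define u :: skorokhod where "u = to_skorokhod (\<lambda>_. 1)"
  have u: "path u t = 1" if "t \<in> {0..1}" for t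
    using that by (simp add: u_def path_to_skorokhod cadlag01_const)
  have "norm u \<le> 1" by (rule norm_skorokhod_le) (simp add: u)
  moreover have "1 \<le> norm u" using abs_path_le_norm[of 0 u] by (simp add: u)
  ultimately show "norm (to_skorokhod (\<lambda>_. 1)) = 1" by (simp add: u_def)
qed

lemma form_norm_leI:
  fixes q :: "skorokhod \<Rightarrow> real"
  assumes "\<And>u. norm u = 1 \<Longrightarrow> \<bar>q u\<bar> \<le> C"
  shows "form_norm q \<le> C"
  unfolding form_norm_def using exists_unit_skorokhod assms by (intro cSUP_least) auto

text \<open>The constant \<open>C\<close> serves only to certify that the set is bounded above, so
  that the real supremum is genuine.\<close>

lemma abs_le_form_norm:
  fixes q :: "'a::real_normed_vector \<Rightarrow> real"
  assumes "\<And>u. norm u = 1 \<Longrightarrow> \<bar>q u\<bar> \<le> C" and "norm u = 1"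
  shows "\<bar>q u\<bar> \<le> form_norm q"
  unfolding form_norm_def using assms
  by (intro cSUP_upper bdd_aboveI2[where M = C]) auto

lemma abs_linear_le_form_norm:
  fixes B :: "'a::real_normed_vector \<Rightarrow>\<^sub>L real"
  assumes "norm u = 1"
  shows "\<bar>B u\<bar> \<le> form_norm (\<lambda>u. B u)"
  by (rule abs_le_form_norm[OF _ assms, of _ "norm B"]) (metis norm_blinfun real_norm_def mult.right_neutral)

lemma abs_quadratic_le_form_norm:
  fixes B :: "'a::real_normed_vector \<Rightarrow>\<^sub>L 'a \<Rightarrow>\<^sub>L real"
  assumes "norm u = 1"
  shows "\<bar>B u u\<bar> \<le> form_norm (\<lambda>u. B u u)"
proof (rule abs_le_form_norm[OF _ assms])
  fix v :: 'a assume "norm v = 1"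
  then show "\<bar>B v v\<bar> \<le> norm B"
    using norm_blinfun[of "B v" v] norm_blinfun[of B v] by simp
qed

text \<open>Homogeneity of degree two extends the bound from the unit sphere. No polarisation
  occurs, so passing to the diagonal norm costs no constant.\<close>

lemma abs_quadratic_le_form_norm_mult:
  fixes B :: "'a::real_normed_vector \<Rightarrow>\<^sub>L 'a \<Rightarrow>\<^sub>L real"
  shows "\<bar>B u u\<bar> \<le> form_norm (\<lambda>u. B u u) * norm u ^ 2"
proof (cases "u = 0")
  case False
  define v where "v = sgn u"
  have u: "u = norm u *\<^sub>R v" and v: "norm v = 1"
    using False by (simp_all add: v_def sgn_div_norm norm_sgn)
  have "B u u = norm u ^ 2 * B v v"
    by (subst u, subst (2) u) (simp add: blinfun.scaleR_right blinfun.scaleR_left power2_eq_square)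
  then show ?thesis
    using mult_left_mono[OF abs_quadratic_le_form_norm[OF v, of B], of "norm u ^ 2"]
    by (simp add: abs_mult mult.commute)
qed (simp add: blinfun.zero_right)

lemma form_norm_linear_nonneg: "0 \<le> form_norm (\<lambda>u. blinfun_apply B u)"
  for B :: "skorokhod \<Rightarrow>\<^sub>L real"
  using exists_unit_skorokhod abs_linear_le_form_norm[of _ B] by (meson abs_ge_zero order_trans)

lemma form_norm_quadratic_nonneg: "0 \<le> form_norm (\<lambda>u. blinfun_apply (blinfun_apply B u) u)"
  for B :: "skorokhod \<Rightarrow>\<^sub>L skorokhod \<Rightarrow>\<^sub>L real"
  using exists_unit_skorokhod abs_quadratic_le_form_norm[of _ B] by (meson abs_ge_zero order_trans)

lemma test_functions_growth:
  assumes "f \<in> test_functions"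
  obtains C where "C \<ge> 0" "\<And>w. \<bar>f w\<bar> \<le> C * (1 + norm w ^ 3)"
proof -
  obtain C where "\<And>w. \<bar>f w\<bar> / (1 + norm w ^ 3) \<le> C"
    using assms by (auto simp: test_functions_def bdd_above_def)
  moreover have "0 < 1 + norm w ^ 3" for w :: skorokhod
    by (simp add: add_pos_nonneg)
  ultimately have C: "\<bar>f w\<bar> \<le> C * (1 + norm w ^ 3)" for w
    by (simp add: divide_le_eq)
  moreover from C[of 0] have "C \<ge> 0" by simp
  ultimately show ?thesis using that by blast
qed

text \<open>Bounding one summand of \<open>norm_M\<close> by the sum needs the other suprema to be nonnegative, hence
  their sets to be bounded. For the first derivative this is not part of the definition of the test
  functions: it follows by solving the second-order expansion of \<open>f\<close> around \<open>w\<close>, with an increment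
  of size \<open>1 + norm w\<close>, for the linear term.\<close>

lemma test_functions_lipschitz:
  assumes f: "f \<in> test_functions"
  shows "\<bar>(fderiv2 f (w + h) - fderiv2 f w) u u\<bar> \<le> norm_M f * norm h * norm u ^ 2"
    and "0 \<le> norm_M f"
proof -
  from f have d1: "\<And>w. f differentiable (at w)" and d2: "\<And>w. fderiv f differentiable (at w)"
    by (auto simp: test_functions_def)
  define N where "N = (\<lambda>w h. form_norm (\<lambda>u. (fderiv2 f (w + h) - fderiv2 f w) u u))"
  obtain k where k: "N w h \<le> k * norm h" for w h
    using f by (auto simp: test_functions_def N_def)
  obtain C where C: "C \<ge> 0" "\<And>w. \<bar>f w\<bar> \<le> C * (1 + norm w ^ 3)"
    using test_functions_growth[OF f] by blast
  have N0: "0 \<le> N w h" for w h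
    unfolding N_def by (rule form_norm_quadratic_nonneg)
  obtain u0 :: skorokhod where u0: "norm u0 = 1" using exists_unit_skorokhod by blast
  have k0: "k \<ge> 0" using k[of 0 u0] N0[of 0 u0] u0 by simp
  have lip_k: "\<bar>(fderiv2 f (w + h) - fderiv2 f w) u u\<bar> \<le> k * norm h * norm u ^ 2" for w h u
    using abs_quadratic_le_form_norm_mult[of "fderiv2 f (w + h) - fderiv2 f w" u]
      mult_right_mono[OF k[of w h], of "norm u ^ 2"]
    by (simp add: N_def)
  define S0 where "S0 = (SUP w. \<bar>f w\<bar> / (1 + norm w ^ 3))"
  define S1 where "S1 = (SUP w. form_norm (\<lambda>u. fderiv f w u) / (1 + norm w ^ 2))"
  define S2 where "S2 = (SUP w. form_norm (\<lambda>u. fderiv2 f w u u) / (1 + norm w))"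
  define S3 where "S3 = (SUP (w, h)\<in>UNIV \<times> {h. h \<noteq> 0}. N w h / norm h)"
  have M: "norm_M f = S0 + S1 + S2 + S3"
    by (simp add: norm_M_def S0_def S1_def S2_def S3_def N_def)
  have "bdd_above (range (\<lambda>w. \<bar>f w\<bar> / (1 + norm w ^ 3)))"
    using f by (simp add: test_functions_def)
  then have S0: "S0 \<ge> 0"
    unfolding S0_def by (rule cSUP_upper2[of _ _ 0]) auto
  \<comment> \<open>Linear growth of the second derivative: its size at the origin plus the
    Lipschitz constant times the distance from there.\<close>
  define C2 where "C2 = form_norm (\<lambda>u. fderiv2 f 0 u u) + k"
  have C2: "\<bar>fderiv2 f w u u\<bar> \<le> C2 * (1 + norm w)" if "norm u = 1" for w u
  proof -
    have "\<bar>fderiv2 f w u u\<bar> \<le> \<bar>fderiv2 f 0 u u\<bar> + \<bar>(fderiv2 f (0 + w) - fderiv2 f 0) u u\<bar>"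
      by (simp add: blinfun.diff_left)
    also have "\<dots> \<le> form_norm (\<lambda>u. fderiv2 f 0 u u) + k * norm w * norm u ^ 2"
      by (intro add_mono lip_k abs_quadratic_le_form_norm that)
    also have "\<dots> \<le> C2 * (1 + norm w)"
      using that k0 form_norm_quadratic_nonneg[of "fderiv2 f 0"] by (simp add: C2_def algebra_simps)
    finally show ?thesis .
  qed
  have C20: "C2 \<ge> 0" using k0 form_norm_quadratic_nonneg[of "fderiv2 f 0"] by (simp add: C2_def)
  have "bdd_above (range (\<lambda>w. form_norm (\<lambda>u. fderiv2 f w u u) / (1 + norm w)))"
  proof (rule bdd_aboveI2)
    fix w
    have "form_norm (\<lambda>u. fderiv2 f w u u) \<le> C2 * (1 + norm w)"
      by (rule form_norm_leI) (rule C2)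
    then show "form_norm (\<lambda>u. fderiv2 f w u u) / (1 + norm w) \<le> C2"
      by (simp add: divide_le_eq add_pos_nonneg)
  qed
  then have S2: "S2 \<ge> 0"
    unfolding S2_def by (rule cSUP_upper2[of _ _ 0]) (auto simp: form_norm_quadratic_nonneg)
  \<comment> \<open>In units of \<open>y ^ 3\<close> with \<open>y = 1 + norm w\<close>: 9 C bounds
    \<open>f\<close> at the shifted point, since 1 + (2 y)^3 \<le> 9 y^3; C bounds
    \<open>f w\<close>; C2/2 bounds the quadratic term and k/2 the Taylor remainder.\<close>
  define C1 where "C1 = 10 * C + C2 / 2 + k / 2"
  have C1: "\<bar>fderiv f w u\<bar> \<le> 2 * C1 * (1 + norm w ^ 2)" if u: "norm u = 1" for w u
  proof -
    define y where "y = 1 + norm w"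
    have y: "y \<ge> 1" "y > 0" "norm w \<le> y" by (simp_all add: y_def add_pos_nonneg)
    have y3: "1 \<le> y ^ 3" using y by (simp add: one_le_power)
    have "norm (w + y *\<^sub>R u) \<le> norm w + norm (y *\<^sub>R u)" by (rule norm_triangle_ineq)
    also have "\<dots> \<le> 2 * y" using y u by simp
    finally have "norm (w + y *\<^sub>R u) ^ 3 \<le> (2 * y) ^ 3" by (intro power_mono) auto
    then have "C * (1 + norm (w + y *\<^sub>R u) ^ 3) \<le> C * (9 * y ^ 3)"
      using y3 C(1) by (intro mult_left_mono) (auto simp: power_mult_distrib)
    then have a: "\<bar>f (w + y *\<^sub>R u)\<bar> \<le> 9 * C * y ^ 3" using C(2)[of "w + y *\<^sub>R u"] by simp
    have "norm w ^ 3 \<le> y ^ 3 - 1" by (simp add: y_def power3_eq_cube algebra_simps)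
    then have "C * (1 + norm w ^ 3) \<le> C * y ^ 3" using C(1) by (intro mult_left_mono) auto
    then have b: "\<bar>f w\<bar> \<le> C * y ^ 3" using C(2)[of w] by simp
    have "y ^ 2 / 2 * \<bar>fderiv2 f w u u\<bar> \<le> y ^ 2 / 2 * (C2 * y)"
      using C2[OF u, of w] by (intro mult_left_mono) (auto simp: y_def)
    then have c: "\<bar>y ^ 2 * (fderiv2 f w u u / 2)\<bar> \<le> C2 / 2 * y ^ 3"
      by (simp add: abs_mult power3_eq_cube power2_eq_square mult_ac)
    have "\<bar>f (w + y *\<^sub>R u) - (f w + y * fderiv f w u + y ^ 2 * (fderiv2 f w u u / 2))\<bar> \<le> k / 2 * y ^ 3"
      using taylor_second_order[OF d1 d2 lip_k, of w y u] y u by simp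
    with a b c have "\<bar>y * fderiv f w u\<bar> \<le> C1 * y ^ 3"
      unfolding C1_def distrib_right by linarith
    then have "y * \<bar>fderiv f w u\<bar> \<le> y * (C1 * y ^ 2)"
      using y by (simp add: abs_mult power3_eq_cube power2_eq_square mult_ac)
    then have "\<bar>fderiv f w u\<bar> \<le> C1 * y ^ 2" using y by simp
    also have "\<dots> \<le> C1 * (2 * (1 + norm w ^ 2))"
    proof (rule mult_left_mono)
      have "0 \<le> (1 - norm w) ^ 2" by simp
      then show "y ^ 2 \<le> 2 * (1 + norm w ^ 2)"
        by (simp add: y_def power2_eq_square algebra_simps)
      show "0 \<le> C1" using C k0 C20 by (simp add: C1_def)
    qed
    finally show ?thesis by (simp add: algebra_simps)
  qed
  have "bdd_above (range (\<lambda>w. form_norm (\<lambda>u. fderiv f w u) / (1 + norm w ^ 2)))"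
  proof (rule bdd_aboveI2)
    fix w
    have "form_norm (\<lambda>u. fderiv f w u) \<le> 2 * C1 * (1 + norm w ^ 2)"
      by (rule form_norm_leI) (rule C1)
    then show "form_norm (\<lambda>u. fderiv f w u) / (1 + norm w ^ 2) \<le> 2 * C1"
      by (simp add: divide_le_eq add_pos_nonneg)
  qed
  then have S1: "S1 \<ge> 0"
    unfolding S1_def by (rule cSUP_upper2[of _ _ 0]) (auto simp: form_norm_linear_nonneg)
  have bdd3: "bdd_above ((\<lambda>(w, h). N w h / norm h) ` (UNIV \<times> {h. h \<noteq> 0}))"
    using k by (intro bdd_aboveI2[where M = k]) (auto simp: divide_le_eq)
  have S3: "N w h \<le> S3 * norm h" if "h \<noteq> 0" for w h
  proof -
    have "(case (w, h) of (w, h) \<Rightarrow> N w h / norm h) \<le> S3"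
      unfolding S3_def by (rule cSUP_upper[OF _ bdd3]) (use that in auto)
    then show ?thesis using that by (simp add: divide_le_eq)
  qed
  \<comment> \<open>A nonzero increment is needed to bring the supremum into play; the unit path
    \<open>u0\<close> supplies one.\<close>
  have S30: "S3 \<ge> 0"
    using N0[of 0 u0] S3[of u0 0] u0 by force
  show "0 \<le> norm_M f" using M S0 S1 S2 S30 by simp
  show "\<bar>(fderiv2 f (w + h) - fderiv2 f w) u u\<bar> \<le> norm_M f * norm h * norm u ^ 2"
  proof (cases "h = 0")
    case False
    have "N w h \<le> S3 * norm h" by (rule S3[OF False])
    also have "\<dots> \<le> norm_M f * norm h" using M S0 S1 S2 by (intro mult_right_mono) auto
    finally show ?thesis
      using abs_quadratic_le_form_norm_mult[of "fderiv2 f (w + h) - fderiv2 f w" u]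
        mult_right_mono[of "N w h" "norm_M f * norm h" "norm u ^ 2"]
      by (simp add: N_def)
  qed simp
qed


section \<open>Replacement in product measures\<close>

lemma integrable_abs_power_le:
  fixes \<mu> :: "real measure"
  assumes "prob_space \<mu>" and [measurable_cong]: "sets \<mu> = sets borel"
    and "integrable \<mu> (\<lambda>y. \<bar>y\<bar> ^ n)" and "m \<le> n"
  shows "integrable \<mu> (\<lambda>y. y ^ m)"
proof -
  interpret prob_space \<mu> by fact
  have "integrable \<mu> (\<lambda>y. 1 + \<bar>y\<bar> ^ n)" using assms(3) by simp
  then show ?thesis
  proof (rule Bochner_Integration.integrable_bound)
    have "\<bar>y\<bar> ^ m \<le> 1 + \<bar>y\<bar> ^ n" for y :: real
      using power_increasing[OF \<open>m \<le> n\<close>, of "\<bar>y\<bar>"] power_le_one[of "\<bar>y\<bar>" m]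
      by (cases "\<bar>y\<bar> \<ge> 1") (auto simp: add.commute intro: add_increasing add_increasing2)
    then show "AE y in \<mu>. norm (y ^ m) \<le> norm (1 + \<bar>y\<bar> ^ n)"
      by (auto simp: power_abs)
  qed measurable
qed

text \<open>The quadratic polynomial has the same integral under both laws because two moments
  agree, so only the two cubic remainders survive. Integrability of \<open>h\<close> is a
  consequence: \<open>h\<close> differs from an integrable polynomial by a dominated
  function.\<close>

lemma lindeberg_swap:
  fixes \<mu> \<nu> :: "real measure"
  assumes \<mu>: "prob_space \<mu>" "sets \<mu> = sets borel" "integrable \<mu> (\<lambda>y. \<bar>y\<bar> ^ 3)"
    and \<nu>: "prob_space \<nu>" "sets \<nu> = sets borel" "integrable \<nu> (\<lambda>y. \<bar>y\<bar> ^ 3)"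
    and mean: "(\<integral>y. y \<partial>\<mu>) = (\<integral>y. y \<partial>\<nu>)" and var: "(\<integral>y. y ^ 2 \<partial>\<mu>) = (\<integral>y. y ^ 2 \<partial>\<nu>)"
    and h: "h \<in> borel_measurable borel"
    and expansion: "\<And>y. \<bar>h y - (a + y * b + y ^ 2 * c)\<bar> \<le> L * \<bar>y\<bar> ^ 3"
  shows "\<bar>(\<integral>y. h y \<partial>\<mu>) - (\<integral>y. h y \<partial>\<nu>)\<bar> \<le> L * ((\<integral>y. \<bar>y\<bar> ^ 3 \<partial>\<mu>) + (\<integral>y. \<bar>y\<bar> ^ 3 \<partial>\<nu>))"
proof -
  have *: "\<bar>(\<integral>y. h y \<partial>\<rho>) - (a + b * (\<integral>y. y \<partial>\<rho>) + c * (\<integral>y. y ^ 2 \<partial>\<rho>))\<bar> \<le> L * (\<integral>y. \<bar>y\<bar> ^ 3 \<partial>\<rho>)"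
    if \<rho>: "prob_space \<rho>" "sets \<rho> = sets borel" "integrable \<rho> (\<lambda>y. \<bar>y\<bar> ^ 3)" for \<rho> :: "real measure"
  proof -
    interpret prob_space \<rho> by fact
    note \<rho>(2)[measurable_cong] h[measurable]
    define q where "q = (\<lambda>y::real. a + y * b + y ^ 2 * c)"
    have [measurable]: "q \<in> borel_measurable borel" by (simp add: q_def)
    have i1: "integrable \<rho> (\<lambda>y. y)" using integrable_abs_power_le[OF \<rho>, of 1] by simp
    have i2: "integrable \<rho> (\<lambda>y. y ^ 2)" using integrable_abs_power_le[OF \<rho>, of 2] by simp
    have q: "integrable \<rho> q" unfolding q_def using i1 i2 by simp
    have Iq: "(\<integral>y. q y \<partial>\<rho>) = a + b * (\<integral>y. y \<partial>\<rho>) + c * (\<integral>y. y ^ 2 \<partial>\<rho>)"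
      unfolding q_def using i1 i2 by (simp add: prob_space mult.commute)
    have L: "integrable \<rho> (\<lambda>y. L * \<bar>y\<bar> ^ 3)" using \<rho>(3) by simp
    have d: "integrable \<rho> (\<lambda>y. h y - q y)"
      using expansion by (intro Bochner_Integration.integrable_bound[OF L])
        (auto simp: q_def intro: order_trans[OF _ abs_ge_self])
    have "integrable \<rho> (\<lambda>y. (h y - q y) + q y)" using d q by (rule Bochner_Integration.integrable_add)
    then have hi: "integrable \<rho> h" by simp
    have "\<bar>(\<integral>y. h y \<partial>\<rho>) - (\<integral>y. q y \<partial>\<rho>)\<bar> = \<bar>\<integral>y. h y - q y \<partial>\<rho>\<bar>"
      using hi q by simp
    also have "\<dots> \<le> (\<integral>y. \<bar>h y - q y\<bar> \<partial>\<rho>)" by (rule integral_abs_bound)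
    also have "\<dots> \<le> (\<integral>y. L * \<bar>y\<bar> ^ 3 \<partial>\<rho>)"
      using d L expansion by (intro integral_mono) (auto simp: q_def)
    finally show ?thesis by (simp add: Iq)
  qed
  show ?thesis
    using *[OF \<mu>] *[OF \<nu>] unfolding mean var distrib_left by linarith
qed

text \<open>Each term is at most the maximum, whose power is one of the summands on the right. The
  constant is crude, but the lemma serves only to prove integrability.\<close>

lemma sum_power_le_card_power:
  fixes b :: "'i \<Rightarrow> real"
  assumes "finite E" and "\<And>e. e \<in> E \<Longrightarrow> 0 \<le> b e" and "0 < k"
  shows "(\<Sum>e\<in>E. b e) ^ k \<le> real (card E) ^ k * (\<Sum>e\<in>E. b e ^ k)"
proof (cases "E = {}")
  case False
  define m where "m = Max (b ` E)"
  have "m \<in> b ` E" unfolding m_def using assms(1) False by (intro Max_in) auto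
  then obtain e where e: "e \<in> E" "m = b e" by auto
  have "(\<Sum>e\<in>E. b e) \<le> (\<Sum>e\<in>E. m)"
    unfolding m_def using assms(1) by (intro sum_mono) auto
  then have "(\<Sum>e\<in>E. b e) ^ k \<le> (real (card E) * m) ^ k"
    using assms(2) by (intro power_mono sum_nonneg) auto
  also have "\<dots> = real (card E) ^ k * b e ^ k" by (simp add: e power_mult_distrib)
  also have "\<dots> \<le> real (card E) ^ k * (\<Sum>e\<in>E. b e ^ k)"
    using assms e by (intro mult_left_mono member_le_sum) auto
  finally show ?thesis .
qed (use assms(3) in \<open>simp add: zero_power\<close>)

context
  fixes E :: "'i::countable set" and \<phi> :: "'i \<Rightarrow> 'b::real_normed_vector" and f :: "'b \<Rightarrow> real"
    and C :: real
  assumes E: "finite E" and f_cont: "continuous_on UNIV f"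
    and f_growth: "\<And>w. \<bar>f w\<bar> \<le> C * (1 + norm w ^ 3)"
begin

text \<open>Borel measurability of \<open>f\<close> on a nonseparable space would not make \<open>f\<close> of a random sum
  measurable; continuity makes it a continuous function of the coefficients.\<close>

lemma measurable_comp_sum:
  assumes "\<And>e. e \<in> E \<Longrightarrow> sets (M e) = sets borel"
  shows "(\<lambda>x. f (\<Sum>e\<in>E. x e *\<^sub>R \<phi> e)) \<in> borel_measurable (PiM E M)"
proof -
  have "continuous_on UNIV (\<lambda>x :: 'i \<Rightarrow> real. f (\<Sum>e\<in>E. x e *\<^sub>R \<phi> e))"
    by (intro continuous_on_compose2[OF f_cont] continuous_intros
        continuous_on_product_coordinates subset_UNIV)
  then have f: "(\<lambda>x :: 'i \<Rightarrow> real. f (\<Sum>e\<in>E. x e *\<^sub>R \<phi> e)) \<in> borel_measurable borel"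
    by (rule borel_measurable_continuous_onI)
  \<comment> \<open>Points of \<open>PiM E M\<close> are \<open>undefined\<close> outside
    \<open>E\<close>; they are extended by zero to total functions. Since the index type is
    countable, measurability of all coordinates gives Borel measurability for the product
    topology.\<close>
  have "(\<lambda>x e. if e \<in> E then x e else 0) \<in> borel_measurable (PiM E M)"
  proof (rule measurable_coordinatewise_then_product)
    fix e
    show "(\<lambda>x. if e \<in> E then x e else 0) \<in> borel_measurable (PiM E M)"
      using measurable_component_singleton[of e E M] assms[of e]
      by (cases "e \<in> E") (auto cong: measurable_cong_sets)
  qed
  from measurable_compose[OF this f] show ?thesis by (simp cong: sum.cong)
qed

text \<open>Cubic growth of \<open>f\<close> turns into a bound by the third powers of the
  individual coordinates, each of which is integrable under its marginal.\<close>

lemma integrable_comp_sum: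
  assumes M: "\<And>e. prob_space (M e)" "\<And>e. sets (M e) = sets borel"
    and third: "\<And>e. integrable (M e) (\<lambda>y. \<bar>y\<bar> ^ 3)"
  shows "integrable (PiM E M) (\<lambda>x. f (\<Sum>e\<in>E. x e *\<^sub>R \<phi> e))"
proof -
  interpret product_prob_space M E
    using M(1) by (auto simp: product_prob_space_def product_prob_space_axioms_def
        product_sigma_finite_def intro: prob_space_imp_sigma_finite)
  interpret prob_space "PiM E M" by (rule prob_space_PiM) (rule M)
  define B where "B = (\<lambda>x. C * (1 + real (card E) ^ 3 * (\<Sum>e\<in>E. norm (\<phi> e) ^ 3 * \<bar>x e\<bar> ^ 3)))"
  have C: "C \<ge> 0" using f_growth[of 0] abs_ge_zero[of "f 0"] by (simp del: abs_ge_zero)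
  have "integrable (PiM E M) (\<lambda>x. \<bar>x e\<bar> ^ 3)" if "e \<in> E" for e
  proof -
    have "integrable (distr (PiM E M) (M e) (\<lambda>x. x e)) (\<lambda>y. \<bar>y\<bar> ^ 3)"
      using third[of e] by (simp add: PiM_component[OF that])
    then show ?thesis
      by (rule integrable_distr[OF measurable_component_singleton[OF that]])
  qed
  then have "integrable (PiM E M) B"
    unfolding B_def
    by (intro integrable_mult_right Bochner_Integration.integrable_add integrable_const
        Bochner_Integration.integrable_sum) auto
  then show ?thesis
  proof (rule Bochner_Integration.integrable_bound[OF _ measurable_comp_sum])
    have "\<bar>f (\<Sum>e\<in>E. x e *\<^sub>R \<phi> e)\<bar> \<le> B x" for x
    proof -
      have "norm (\<Sum>e\<in>E. x e *\<^sub>R \<phi> e) \<le> (\<Sum>e\<in>E. norm (\<phi> e) * \<bar>x e\<bar>)"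
        by (rule order_trans[OF norm_sum]) (simp add: mult.commute)
      then have "norm (\<Sum>e\<in>E. x e *\<^sub>R \<phi> e) ^ 3 \<le> (\<Sum>e\<in>E. norm (\<phi> e) * \<bar>x e\<bar>) ^ 3"
        by (intro power_mono) auto
      also have "\<dots> \<le> real (card E) ^ 3 * (\<Sum>e\<in>E. (norm (\<phi> e) * \<bar>x e\<bar>) ^ 3)"
        by (rule sum_power_le_card_power[OF E]) simp_all
      finally have "C * (1 + norm (\<Sum>e\<in>E. x e *\<^sub>R \<phi> e) ^ 3) \<le> B x"
        unfolding B_def using C by (intro mult_left_mono add_left_mono) (auto simp: power_mult_distrib)
      with f_growth show ?thesis by (rule order_trans)
    qed
    then show "AE x in PiM E M. norm (f (\<Sum>e\<in>E. x e *\<^sub>R \<phi> e)) \<le> norm (B x)"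
      by (auto intro: order_trans[OF _ abs_ge_self])
  qed (rule M)
qed

text \<open>Induction over the set of coordinates already exchanged; the errors telescope.
  \<open>d\<close> and \<open>d2\<close> stand for arbitrary functions: what matters is that the
  expansion coefficients depend on base point and direction but not on \<open>y\<close>.\<close>

lemma lindeberg_PiM:
  assumes \<mu>: "prob_space \<mu>" "sets \<mu> = sets borel" "integrable \<mu> (\<lambda>y. \<bar>y\<bar> ^ 3)"
    and \<nu>: "prob_space \<nu>" "sets \<nu> = sets borel" "integrable \<nu> (\<lambda>y. \<bar>y\<bar> ^ 3)"
    and mean: "(\<integral>y. y \<partial>\<mu>) = (\<integral>y. y \<partial>\<nu>)" and var: "(\<integral>y. y ^ 2 \<partial>\<mu>) = (\<integral>y. y ^ 2 \<partial>\<nu>)"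
    and expansion: "\<And>w u y. \<bar>f (w + y *\<^sub>R u) - (f w + y * d w u + y ^ 2 * d2 w u)\<bar>
      \<le> L * norm u ^ 3 * \<bar>y\<bar> ^ 3"
  shows "\<bar>(\<integral>x. f (\<Sum>e\<in>E. x e *\<^sub>R \<phi> e) \<partial>PiM E (\<lambda>_. \<mu>)) - (\<integral>x. f (\<Sum>e\<in>E. x e *\<^sub>R \<phi> e) \<partial>PiM E (\<lambda>_. \<nu>))\<bar>
    \<le> (\<Sum>e\<in>E. norm (\<phi> e) ^ 3) * (L * ((\<integral>y. \<bar>y\<bar> ^ 3 \<partial>\<mu>) + (\<integral>y. \<bar>y\<bar> ^ 3 \<partial>\<nu>)))"
proof -
  define F where "F = (\<lambda>x. f (\<Sum>e\<in>E. x e *\<^sub>R \<phi> e))"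
  define R where "R = L * ((\<integral>y. \<bar>y\<bar> ^ 3 \<partial>\<mu>) + (\<integral>y. \<bar>y\<bar> ^ 3 \<partial>\<nu>))"
  \<comment> \<open>The hybrid laws: coordinates in \<open>A\<close> already follow \<mu>, the
    others still follow \<nu>.\<close>
  define M where "M = (\<lambda>A (e :: 'i). if e \<in> A then \<mu> else \<nu>)"
  have M: "prob_space (M A e)" "sets (M A e) = sets borel" "integrable (M A e) (\<lambda>y. \<bar>y\<bar> ^ 3)" for A e
    using \<mu> \<nu> by (auto simp: M_def)
  have F: "integrable (PiM E (M A)) F" for A
    unfolding F_def by (rule integrable_comp_sum) (rule M)+
  have "\<bar>(\<integral>x. F x \<partial>PiM E (M A)) - (\<integral>x. F x \<partial>PiM E (M {}))\<bar> \<le> (\<Sum>e\<in>A. norm (\<phi> e) ^ 3) * R"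
    if "finite A" "A \<subseteq> E" for A
    using that
  proof (induction A rule: finite_induct)
    case (insert a A)
    define E' where "E' = E - {a}"
    have E': "finite E'" "a \<notin> E'" "insert a E' = E" using E insert.prems by (auto simp: E'_def)
    \<comment> \<open>The hybrids for \<open>A\<close> and \<open>insert a A\<close> agree off
      \<open>a\<close>, so \<open>N\<close> is the common law of the remaining coordinates and only
      the inner integral over coordinate \<open>a\<close> changes.\<close>
    define N where "N = PiM E' (M A)"
    interpret N: prob_space N unfolding N_def by (rule prob_space_PiM) (rule M)
    define G where "G = (\<lambda>x y. f ((\<Sum>e\<in>E'. x e *\<^sub>R \<phi> e) + y *\<^sub>R \<phi> a))"
    have G: "F (x(a := y)) = G x y" for x y
    proof -
      have "(\<Sum>e\<in>E'. (x(a := y)) e *\<^sub>R \<phi> e) = (\<Sum>e\<in>E'. x e *\<^sub>R \<phi> e)"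
        using E'(2) by (intro sum.cong) auto
      then show ?thesis
        unfolding F_def G_def E'(3)[symmetric] using E'(1,2) by (simp add: add.commute)
    qed
    have split: "integrable N (\<lambda>x. \<integral>y. G x y \<partial>M B a)"
      "(\<integral>x. F x \<partial>PiM E (M B)) = (\<integral>x. (\<integral>y. G x y \<partial>M B a) \<partial>N)"
      if B: "B = A \<or> B = insert a A" for B
    proof -
      interpret Ba: prob_space "M B a" by (rule M)
      interpret pair_prob_space "M B a" N ..
      have N: "N = PiM E' (M B)"
        unfolding N_def using B E'(2) by (intro PiM_cong) (auto simp: M_def)
      have "distr (M B a \<Otimes>\<^sub>M PiM E' (M B)) (PiM E (M B)) (\<lambda>(y, x). x(a := y)) = PiM E (M B)"
        unfolding E'(3)[symmetric] by (rule distr_pair_PiM_eq_PiM) (rule M)+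
      then have D: "distr (M B a \<Otimes>\<^sub>M N) (PiM E (M B)) (\<lambda>(y, x). x(a := y)) = PiM E (M B)"
        by (simp add: N)
      have meas: "(\<lambda>(y, x). x(a := y)) \<in> measurable (M B a \<Otimes>\<^sub>M N) (PiM E (M B))"
        unfolding N E'(3)[symmetric] by measurable
      \<comment> \<open>Joint integrability, needed for Fubini, is pulled back from integrability of
        \<open>F\<close> along the map that glues coordinate \<open>a\<close> to the rest.\<close>
      have "integrable (M B a \<Otimes>\<^sub>M N) (\<lambda>z. F (case z of (y, x) \<Rightarrow> x(a := y)))"
        using F[of B] by (intro integrable_distr[OF meas]) (simp add: D)
      then have int: "integrable (M B a \<Otimes>\<^sub>M N) (\<lambda>(y, x). G x y)"
        by (simp add: G split_beta')
      show "integrable N (\<lambda>x. \<integral>y. G x y \<partial>M B a)"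
        using integrable_snd[OF int] .
      have "(\<integral>x. F x \<partial>PiM E (M B)) = (\<integral>z. F (case z of (y, x) \<Rightarrow> x(a := y)) \<partial>(M B a \<Otimes>\<^sub>M N))"
        by (subst D[symmetric], rule integral_distr[OF meas])
          (use F[of B] in \<open>simp add: borel_measurable_integrable\<close>)
      also have "\<dots> = (\<integral>(y, x). G x y \<partial>(M B a \<Otimes>\<^sub>M N))" by (simp add: G split_beta')
      also have "\<dots> = (\<integral>x. (\<integral>y. G x y \<partial>M B a) \<partial>N)" using integral_snd[OF int] by simp
      finally show "(\<integral>x. F x \<partial>PiM E (M B)) = (\<integral>x. (\<integral>y. G x y \<partial>M B a) \<partial>N)" .
    qed
    have a: "M (insert a A) a = \<mu>" "M A a = \<nu>" using insert.hyps by (auto simp: M_def)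
    \<comment> \<open>With the other coordinates frozen, their sum \<open>w\<close> is the base
      point and \<open>\<phi> a\<close> the direction of the expansion.\<close>
    have swap: "\<bar>(\<integral>y. G x y \<partial>\<mu>) - (\<integral>y. G x y \<partial>\<nu>)\<bar> \<le> norm (\<phi> a) ^ 3 * R" for x
    proof -
      define w where "w = (\<Sum>e\<in>E'. x e *\<^sub>R \<phi> e)"
      have "continuous_on UNIV (\<lambda>y. f (w + y *\<^sub>R \<phi> a))"
        by (intro continuous_on_compose2[OF f_cont] continuous_intros subset_UNIV)
      then have "(\<lambda>y. f (w + y *\<^sub>R \<phi> a)) \<in> borel_measurable borel"
        by (rule borel_measurable_continuous_onI)
      from lindeberg_swap[OF \<mu> \<nu> mean var this expansion]
      show ?thesis by (simp add: G_def R_def w_def mult_ac)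
    qed
    have "\<bar>(\<integral>x. F x \<partial>PiM E (M (insert a A))) - (\<integral>x. F x \<partial>PiM E (M A))\<bar>
      = \<bar>\<integral>x. (\<integral>y. G x y \<partial>\<mu>) - (\<integral>y. G x y \<partial>\<nu>) \<partial>N\<bar>"
      using split[of A] split[of "insert a A"] by (simp add: a)
    also have "\<dots> \<le> (\<integral>x. \<bar>(\<integral>y. G x y \<partial>\<mu>) - (\<integral>y. G x y \<partial>\<nu>)\<bar> \<partial>N)"
      by (rule integral_abs_bound)
    also have "\<dots> \<le> (\<integral>x. norm (\<phi> a) ^ 3 * R \<partial>N)"
      using split(1)[of A] split(1)[of "insert a A"] swap by (intro integral_mono) (auto simp: a)
    also have "\<dots> = norm (\<phi> a) ^ 3 * R" by (simp add: N.prob_space)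
    finally show ?case
      using insert.IH insert.prems insert.hyps by (simp add: distrib_right)
  qed simp
  from this[OF E order.refl]
  have "\<bar>(\<integral>x. F x \<partial>PiM E (M E)) - (\<integral>x. F x \<partial>PiM E (M {}))\<bar> \<le> (\<Sum>e\<in>E. norm (\<phi> e) ^ 3) * R" .
  moreover have "PiM E (M E) = PiM E (\<lambda>_. \<mu>)" "PiM E (M {}) = PiM E (\<lambda>_. \<nu>)"
    by (auto intro!: PiM_cong simp: M_def)
  ultimately show ?thesis by (simp add: F_def R_def)
qed

end


section \<open>Independence from characteristic functions\<close>

context prob_space
begin

text \<open>Change of measure: reweighting by the normalised density (2 + U)/v leaves the
  characteristic function of \<open>X\<close> unchanged, by the factorization hypothesis. Hence the
  law of \<open>X\<close> is unchanged as well, and solving the resulting identity for the part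
  linear in \<open>U\<close> gives the claim.\<close>

lemma char_factor_imp_prob_factor_real:
  fixes U :: "'a \<Rightarrow> real"
  assumes X[measurable]: "X \<in> borel_measurable M" and U[measurable]: "U \<in> borel_measurable M"
    and bound: "\<And>\<omega>. \<bar>U \<omega>\<bar> \<le> 1"
    and factor: "\<And>a. (\<integral>\<omega>. iexp (a * X \<omega>) * U \<omega> \<partial>M) = char (distr M borel X) a * (\<integral>\<omega>. U \<omega> \<partial>M)"
    and A[measurable]: "A \<in> sets borel"
  shows "(\<integral>\<omega>. indicator A (X \<omega>) * U \<omega> \<partial>M) = (\<integral>\<omega>. indicator A (X \<omega>) \<partial>M) * (\<integral>\<omega>. U \<omega> \<partial>M)"
proof -
  have U_int: "integrable M U" by (rule integrable_const_bound[where B = 1]) (use bound in auto)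
  \<comment> \<open>The shift 2 instead of 1 keeps the total mass \<open>v\<close> at least 1; a
    shift by 1 could give the zero measure.\<close>
  define v where "v = 2 + (\<integral>\<omega>. U \<omega> \<partial>M)"
  define V where "V = (\<lambda>\<omega>. (2 + U \<omega>) / v)"
  have "\<bar>\<integral>\<omega>. U \<omega> \<partial>M\<bar> \<le> (\<integral>\<omega>. 1 \<partial>M)"
    by (rule order_trans[OF integral_abs_bound]) (intro integral_mono, use U_int bound in auto)
  then have v: "v > 0" by (simp add: v_def prob_space)
  have V0: "0 \<le> V \<omega>" for \<omega> using bound[of \<omega>] v by (simp add: V_def abs_le_iff)
  have [measurable]: "V \<in> borel_measurable M" by (simp add: V_def)
  have V1: "(\<integral>\<omega>. V \<omega> \<partial>M) = 1" using U_int v by (simp add: V_def prob_space v_def)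
  have V_int: "integrable M V" using U_int by (simp add: V_def)
  define M' where "M' = density M V"
  have "emeasure M' (space M') = 1"
    using V1 by (simp add: M'_def emeasure_density nn_integral_eq_integral[OF V_int] V0 cong: nn_integral_cong)
  then interpret M': prob_space M' by (rule prob_spaceI)
  have [measurable]: "X \<in> borel_measurable M'" by (simp add: M'_def)
  have "char (distr M' borel X) a = char (distr M borel X) a" for a
  proof -
    have i: "integrable M (\<lambda>\<omega>. iexp (a * X \<omega>))" "integrable M (\<lambda>\<omega>. iexp (a * X \<omega>) * U \<omega>)"
      using bound by (auto intro!: integrable_const_bound[where B = 1] simp: norm_mult)
    have "char (distr M' borel X) a = (\<integral>\<omega>. iexp (a * X \<omega>) \<partial>M')"
      unfolding char_def by (rule integral_distr) measurable
    also have "\<dots> = (\<integral>\<omega>. V \<omega> *\<^sub>R iexp (a * X \<omega>) \<partial>M)"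
      unfolding M'_def by (rule integral_density) (auto simp: V0)
    also have "\<dots> = (\<integral>\<omega>. (2 * iexp (a * X \<omega>) + iexp (a * X \<omega>) * U \<omega>) / v \<partial>M)"
      by (intro Bochner_Integration.integral_cong) (auto simp: V_def scaleR_conv_of_real field_simps)
    also have "\<dots> = (2 * (\<integral>\<omega>. iexp (a * X \<omega>) \<partial>M) + (\<integral>\<omega>. iexp (a * X \<omega>) * U \<omega> \<partial>M)) / v"
      using i by simp
    also have "(\<integral>\<omega>. iexp (a * X \<omega>) \<partial>M) = char (distr M borel X) a"
      unfolding char_def by (rule integral_distr[symmetric]) measurable
    also note factor
    also have "(2 * char (distr M borel X) a + char (distr M borel X) a * (\<integral>\<omega>. U \<omega> \<partial>M)) / v =
      char (distr M borel X) a * of_real v / of_real v"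
      by (simp add: v_def algebra_simps)
    finally show ?thesis using v by simp
  qed
  then have eq: "distr M' borel X = distr M borel X"
    by (intro Levy_uniqueness ext real_distribution_distr M'.real_distribution_distr) simp_all
  have "(\<integral>\<omega>. indicator A (X \<omega>) \<partial>M') = (\<integral>x. indicator A x \<partial>distr M' borel X :: real)"
    by (rule integral_distr[symmetric]) measurable
  also have "\<dots> = (\<integral>\<omega>. indicator A (X \<omega>) \<partial>M)"
    unfolding eq by (rule integral_distr) measurable
  finally have "(\<integral>\<omega>. indicator A (X \<omega>) \<partial>M) = (\<integral>\<omega>. indicator A (X \<omega>) \<partial>M' :: real)" ..
  also have "\<dots> = (\<integral>\<omega>. V \<omega> *\<^sub>R indicator A (X \<omega>) \<partial>M)"
    unfolding M'_def by (rule integral_density) (auto simp: V0)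
  also have "\<dots> = (\<integral>\<omega>. (2 * indicator A (X \<omega>) + indicator A (X \<omega>) * U \<omega>) / v \<partial>M)"
    by (intro Bochner_Integration.integral_cong) (auto simp: V_def field_simps)
  also have "\<dots> = (2 * (\<integral>\<omega>. indicator A (X \<omega>) \<partial>M) + (\<integral>\<omega>. indicator A (X \<omega>) * U \<omega> \<partial>M)) / v"
  proof -
    have "integrable M (\<lambda>\<omega>. indicator A (X \<omega>) :: real)" "integrable M (\<lambda>\<omega>. indicator A (X \<omega>) * U \<omega>)"
      using bound by (auto intro!: integrable_const_bound[where B = 1] simp: abs_mult indicator_def)
    then show ?thesis by simp
  qed
  finally show ?thesis using v by (simp add: field_simps v_def)
qed

text \<open>For fixed bounded \<open>W\<close> this is uniqueness of characteristic functions for the complex measure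
  with density \<open>W\<close>; it is reduced to probability measures through \<open>2 + Re W\<close> and \<open>2 + Im W\<close>.\<close>

lemma char_factor_imp_prob_factor:
  fixes W :: "'a \<Rightarrow> complex"
  assumes X[measurable]: "X \<in> borel_measurable M" and W[measurable]: "W \<in> borel_measurable M"
    and bound: "\<And>\<omega>. norm (W \<omega>) \<le> 1"
    and factor: "\<And>a. (\<integral>\<omega>. iexp (a * X \<omega>) * W \<omega> \<partial>M) = char (distr M borel X) a * (\<integral>\<omega>. W \<omega> \<partial>M)"
    and A[measurable]: "A \<in> sets borel"
  shows "(\<integral>\<omega>. indicator A (X \<omega>) * W \<omega> \<partial>M) = prob (X -` A \<inter> space M) * (\<integral>\<omega>. W \<omega> \<partial>M)"
proof -
  define ch where "ch = char (distr M borel X)"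
  have W_int: "integrable M W" by (rule integrable_const_bound[where B = 1]) (use bound in auto)
  have cnj_measurable: "cnj \<in> borel_measurable borel"
    by (intro borel_measurable_continuous_onI continuous_intros)
  have [measurable]: "(\<lambda>\<omega>. cnj (W \<omega>)) \<in> borel_measurable M"
    using measurable_compose[OF W cnj_measurable] .
  have i: "integrable M (\<lambda>\<omega>. iexp (a * X \<omega>) * W \<omega>)" "integrable M (\<lambda>\<omega>. iexp (a * X \<omega>) * cnj (W \<omega>))" for a
    using bound by (auto intro!: integrable_const_bound[where B = 1] simp: norm_mult)
  have cnj_ch: "cnj (ch (- a)) = ch a" for a
    unfolding ch_def char_def by (subst Bochner_Integration.integral_cnj[symmetric]) (simp add: exp_cnj)
  \<comment> \<open>Conjugation reverses the sign of the frequency, so the hypothesis at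
    \<open>- a\<close> yields the factorization for \<open>cnj W\<close>. Real and imaginary parts
    are combinations of \<open>W\<close> and \<open>cnj W\<close>.\<close>
  have factor_cnj: "(\<integral>\<omega>. iexp (a * X \<omega>) * cnj (W \<omega>) \<partial>M) = ch a * cnj (\<integral>\<omega>. W \<omega> \<partial>M)" for a
  proof -
    have "(\<integral>\<omega>. iexp (a * X \<omega>) * cnj (W \<omega>) \<partial>M) = cnj (\<integral>\<omega>. iexp (- a * X \<omega>) * W \<omega> \<partial>M)"
      by (subst Bochner_Integration.integral_cnj[symmetric]) (simp add: exp_cnj)
    also have "\<dots> = ch a * cnj (\<integral>\<omega>. W \<omega> \<partial>M)"
      unfolding factor by (simp add: cnj_ch flip: ch_def)
    finally show ?thesis .
  qed
  have Re_W: "(\<integral>\<omega>. iexp (a * X \<omega>) * Re (W \<omega>) \<partial>M) = ch a * (\<integral>\<omega>. Re (W \<omega>) \<partial>M)" for a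
  proof -
    have "(\<integral>\<omega>. iexp (a * X \<omega>) * Re (W \<omega>) \<partial>M) =
      (\<integral>\<omega>. (iexp (a * X \<omega>) * W \<omega> + iexp (a * X \<omega>) * cnj (W \<omega>)) / 2 \<partial>M)"
      by (simp add: complex_add_cnj flip: distrib_left)
    also have "\<dots> = (ch a * (\<integral>\<omega>. W \<omega> \<partial>M) + ch a * cnj (\<integral>\<omega>. W \<omega> \<partial>M)) / 2"
      using i[of a] factor[of a] factor_cnj[of a] by (simp add: ch_def)
    finally show ?thesis
      using W_int by (simp add: complex_add_cnj flip: distrib_left)
  qed
  have Im_eq: "z * Im w = (z * w - z * cnj w) / (2 * \<i>)" for z w :: complex
  proof -
    have *: "z * w - z * cnj w = z * Im w * (2 * \<i>)"
      by (simp add: complex_diff_cnj flip: right_diff_distrib)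
    show ?thesis by (rule eq_divide_imp[OF _ *[symmetric]]) simp
  qed
  have Im_W: "(\<integral>\<omega>. iexp (a * X \<omega>) * Im (W \<omega>) \<partial>M) = ch a * (\<integral>\<omega>. Im (W \<omega>) \<partial>M)" for a
  proof -
    have "(\<integral>\<omega>. iexp (a * X \<omega>) * Im (W \<omega>) \<partial>M) =
      (ch a * (\<integral>\<omega>. W \<omega> \<partial>M) - ch a * cnj (\<integral>\<omega>. W \<omega> \<partial>M)) / (2 * \<i>)"
      unfolding Im_eq integral_divide_zero using i[of a]
      by (simp only: Bochner_Integration.integral_diff factor factor_cnj ch_def)
    then show ?thesis
      using W_int by (simp only: Im_eq[symmetric] integral_Im)
  qed
  have P: "(\<integral>\<omega>. indicator A (X \<omega>) \<partial>M) = prob (X -` A \<inter> space M)"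
  proof -
    have "(\<integral>\<omega>. indicator A (X \<omega>) \<partial>M) = (\<integral>\<omega>. indicator (X -` A \<inter> space M) \<omega> \<partial>M :: real)"
      by (intro Bochner_Integration.integral_cong) (auto simp: indicator_def)
    then show ?thesis by simp
  qed
  have iA: "integrable M (\<lambda>\<omega>. indicator A (X \<omega>) * W \<omega>)"
    using bound by (auto intro!: integrable_const_bound[where B = 1] simp: norm_mult indicator_def)
  have Re_le: "\<bar>Re (W \<omega>)\<bar> \<le> 1" and Im_le: "\<bar>Im (W \<omega>)\<bar> \<le> 1" for \<omega>
    using bound[of \<omega>] abs_Re_le_cmod[of "W \<omega>"] abs_Im_le_cmod[of "W \<omega>"] by linarith+
  have ind: "Re (indicator A x) = indicator A x" "Im (indicator A x) = 0" for x
    by (auto simp: indicator_def)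
  have "(\<integral>\<omega>. indicator A (X \<omega>) * Re (W \<omega>) \<partial>M) = prob (X -` A \<inter> space M) * (\<integral>\<omega>. Re (W \<omega>) \<partial>M)"
    unfolding P[symmetric]
    by (rule char_factor_imp_prob_factor_real) (use Re_le Re_W in \<open>auto simp: ch_def\<close>)
  moreover have "(\<integral>\<omega>. indicator A (X \<omega>) * Im (W \<omega>) \<partial>M) = prob (X -` A \<inter> space M) * (\<integral>\<omega>. Im (W \<omega>) \<partial>M)"
    unfolding P[symmetric]
    by (rule char_factor_imp_prob_factor_real) (use Im_le Im_W in \<open>auto simp: ch_def\<close>)
  ultimately show ?thesis
    using iA W_int by (intro complex_eqI) (simp_all flip: integral_Re integral_Im add: ind)
qed

text \<open>The exponential factors are replaced by indicators one coordinate at a time. At each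
  stage the indicators already present and the exponentials still left form the bounded weight
  \<open>W\<close> of the preceding lemma. When all are replaced, the identity gives the
  probabilities of measurable rectangles.\<close>

lemma distr_eq_PiM_if_char_factor:
  fixes X :: "'i \<Rightarrow> 'a \<Rightarrow> real"
  assumes E: "finite E" and X: "\<And>e. e \<in> E \<Longrightarrow> X e \<in> borel_measurable M"
    and factor: "\<And>a. (\<integral>\<omega>. iexp (\<Sum>e\<in>E. a e * X e \<omega>) \<partial>M) = (\<Prod>e\<in>E. char (distr M borel (X e)) (a e))"
  shows "distr M (PiM E (\<lambda>_. borel)) (\<lambda>\<omega>. \<lambda>e\<in>E. X e \<omega>) = PiM E (\<lambda>e. distr M borel (X e))"
proof -
  define ch where "ch = (\<lambda>e. char (distr M borel (X e)))"
  have ch_0: "ch e 0 = 1" if "e \<in> E" for e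
    using X[OF that] by (simp add: ch_def char_def measure_distr prob_space)
  \<comment> \<open>The frequencies \<open>a\<close> must stay arbitrary in the induction: the step
    varies the frequency of the coordinate being replaced.\<close>
  have step: "(\<integral>\<omega>. (\<Prod>e\<in>S. indicator (B e) (X e \<omega>)) * iexp (\<Sum>e\<in>E - S. a e * X e \<omega>) \<partial>M) =
      of_real (\<Prod>e\<in>S. prob (X e -` B e \<inter> space M)) * (\<Prod>e\<in>E - S. ch e (a e))"
    if "finite S" "S \<subseteq> E" and B: "\<And>e. e \<in> E \<Longrightarrow> B e \<in> sets borel" for S B a
    using that(1,2)
  proof (induction S arbitrary: a rule: finite_induct)
    case empty
    show ?case using factor[of a] by (simp add: ch_def)
  next
    case (insert s S)
    define W where "W = (\<lambda>\<omega>. (\<Prod>e\<in>S. indicator (B e) (X e \<omega>)) *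
      iexp (\<Sum>e\<in>E - insert s S. a e * X e \<omega>))"
    define q where "q = of_real (\<Prod>e\<in>S. prob (X e -` B e \<inter> space M)) * (\<Prod>e\<in>E - insert s S. ch e (a e))"
    have s: "s \<in> E" "s \<notin> S" "S \<subseteq> E" using insert by auto
    have ES: "E - S = insert s (E - insert s S)" using s by auto
    have W_\<alpha>: "(\<integral>\<omega>. iexp (\<alpha> * X s \<omega>) * W \<omega> \<partial>M) = ch s \<alpha> * q" for \<alpha>
    proof -
      define b where "b = a(s := \<alpha>)"
      have "(\<Sum>e\<in>E - S. b e * X e \<omega>) = \<alpha> * X s \<omega> + (\<Sum>e\<in>E - insert s S. a e * X e \<omega>)" for \<omega>
      proof -
        have "(\<Sum>e\<in>E - insert s S. b e * X e \<omega>) = (\<Sum>e\<in>E - insert s S. a e * X e \<omega>)"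
          by (intro sum.cong) (auto simp: b_def)
        then show ?thesis unfolding ES using E by (simp add: b_def)
      qed
      then have "(\<integral>\<omega>. iexp (\<alpha> * X s \<omega>) * W \<omega> \<partial>M) =
        (\<integral>\<omega>. (\<Prod>e\<in>S. indicator (B e) (X e \<omega>)) * iexp (\<Sum>e\<in>E - S. b e * X e \<omega>) \<partial>M)"
        by (intro Bochner_Integration.integral_cong) (auto simp: W_def distrib_left exp_add)
      also have "\<dots> = of_real (\<Prod>e\<in>S. prob (X e -` B e \<inter> space M)) * (\<Prod>e\<in>E - S. ch e (b e))"
        using insert.IH[of b] s by simp
      also have "(\<Prod>e\<in>E - S. ch e (b e)) = ch s \<alpha> * (\<Prod>e\<in>E - insert s S. ch e (a e))"
      proof -
        have "(\<Prod>e\<in>E - insert s S. ch e (b e)) = (\<Prod>e\<in>E - insert s S. ch e (a e))"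
          by (intro prod.cong) (auto simp: b_def)
        then show ?thesis unfolding ES using E by (simp add: b_def)
      qed
      finally show ?thesis by (simp add: q_def)
    qed
    \<comment> \<open>Frequency 0 identifies the factor \<open>q\<close> as the integral of
      \<open>W\<close>, which puts the identity into the form required for the replacement.\<close>
    have q: "(\<integral>\<omega>. W \<omega> \<partial>M) = q" using W_\<alpha>[of 0] ch_0[OF s(1)] by simp
    have "(\<integral>\<omega>. indicator (B s) (X s \<omega>) * W \<omega> \<partial>M) = prob (X s -` B s \<inter> space M) * (\<integral>\<omega>. W \<omega> \<partial>M)"
    proof (rule char_factor_imp_prob_factor)
      have "(\<lambda>\<omega>. indicator (B e) (X e \<omega>) :: complex) \<in> borel_measurable M" if "e \<in> S" for e
      proof -
        have "e \<in> E" using that s by auto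
        from X[OF this] B[OF this] show ?thesis by measurable
      qed
      then have [measurable]: "(\<lambda>\<omega>. \<Prod>e\<in>S. indicator (B e) (X e \<omega>) :: complex) \<in> borel_measurable M"
        by (rule borel_measurable_prod)
      have [measurable]: "(\<lambda>\<omega>. \<Sum>e\<in>E - insert s S. a e * X e \<omega>) \<in> borel_measurable M"
        by (intro borel_measurable_sum borel_measurable_times) (auto intro: X)
      show "W \<in> borel_measurable M" unfolding W_def by measurable
      show "norm (W \<omega>) \<le> 1" for \<omega>
      proof -
        have "norm (W \<omega>) = (\<Prod>e\<in>S. norm (indicator (B e) (X e \<omega>) :: complex))"
          by (simp add: W_def norm_mult prod_norm)
        also have "\<dots> \<le> 1" by (intro prod_le_1) (auto simp: indicator_def)
        finally show ?thesis .
      qed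
      show "(\<integral>\<omega>. iexp (\<alpha> * X s \<omega>) * W \<omega> \<partial>M) = char (distr M borel (X s)) \<alpha> * (\<integral>\<omega>. W \<omega> \<partial>M)" for \<alpha>
        using W_\<alpha>[of \<alpha>] q by (simp add: ch_def)
    qed (use s X B in auto)
    then show ?case
      using insert.hyps unfolding q by (simp add: W_def q_def mult.assoc)
  qed
  have prob_X: "prob_space (distr M borel (X e))" if "e \<in> E" for e
    using X[OF that] by (rule prob_space_distr)
  \<comment> \<open>The product locale wants a probability measure at every index, so a point mass
    is put outside \<open>E\<close>.\<close>
  define N where "N = (\<lambda>e. if e \<in> E then distr M borel (X e) else return borel 0)"
  have N: "prob_space (N e)" for e using prob_X by (auto simp: N_def intro: prob_space_return)
  have emeasure_M: "emeasure M S = ennreal (measure M S)" for S by (rule emeasure_eq_measure)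
  interpret product_prob_space N E
    using N by (auto simp: product_prob_space_def product_prob_space_axioms_def
        product_sigma_finite_def intro: prob_space_imp_sigma_finite)
  have X_meas: "(\<lambda>\<omega>. \<lambda>e\<in>E. X e \<omega>) \<in> measurable M (PiM E (\<lambda>_. borel))"
    using X by (intro measurable_restrict) auto
  have "distr M (PiM E (\<lambda>_. borel)) (\<lambda>\<omega>. \<lambda>e\<in>E. X e \<omega>) = PiM E N"
  proof (rule PiM_eqI[OF E])
    show "sets (distr M (PiM E (\<lambda>_. borel)) (\<lambda>\<omega>. \<lambda>e\<in>E. X e \<omega>)) = sets (PiM E N)"
      by (auto intro!: sets_PiM_cong simp: N_def)
    fix B assume "\<And>e. e \<in> E \<Longrightarrow> B e \<in> sets (N e)"
    then have B: "\<And>e. e \<in> E \<Longrightarrow> B e \<in> sets borel" by (simp add: N_def)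
    define S where "S = {\<omega> \<in> space M. \<forall>e\<in>E. X e \<omega> \<in> B e}"
    have S: "S = (\<lambda>\<omega>. \<lambda>e\<in>E. X e \<omega>) -` Pi\<^sub>E E B \<inter> space M"
      by (auto simp: S_def PiE_iff)
    have "S \<in> sets M"
      unfolding S using X_meas B E by (intro measurable_sets[OF X_meas] sets_PiM_I_finite) auto
    have "(\<integral>\<omega>. (\<Prod>e\<in>E. indicator (B e) (X e \<omega>)) \<partial>M) = (\<integral>\<omega>. of_real (indicator S \<omega>) \<partial>M :: complex)"
      using E by (intro Bochner_Integration.integral_cong) (auto simp: S_def indicator_def)
    also have "\<dots> = of_real (measure M S)"
      using \<open>S \<in> sets M\<close> by simp
    finally have "of_real (measure M S) = (of_real (\<Prod>e\<in>E. measure M (X e -` B e \<inter> space M)) :: complex)"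
      using step[of E B "\<lambda>_. 0", OF E order.refl B] by simp
    then have "measure M S = (\<Prod>e\<in>E. measure M (X e -` B e \<inter> space M))"
      by (simp only: of_real_eq_iff)
    then have "emeasure M S = (\<Prod>e\<in>E. emeasure M (X e -` B e \<inter> space M))"
      by (simp add: emeasure_M prod_ennreal)
    then show "emeasure (distr M (PiM E (\<lambda>_. borel)) (\<lambda>\<omega>. \<lambda>e\<in>E. X e \<omega>)) (Pi\<^sub>E E B) =
        (\<Prod>e\<in>E. emeasure (N e) (B e))"
      using X_meas X B E by (simp add: emeasure_distr sets_PiM_I_finite S N_def cong: prod.cong)
  qed
  also have "\<dots> = PiM E (\<lambda>e. distr M borel (X e))"
    by (intro PiM_cong) (auto simp: N_def)
  finally show ?thesis .
qed

end


section \<open>Gaussian families\<close>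

text \<open>As a scaled standard normal, the degenerate case \<open>s = 0\<close> needs no separate
  treatment in the moment and characteristic function computations.\<close>

lemma centred_gaussian_eq_distr:
  assumes "s \<ge> 0"
  shows "centred_gaussian s = distr std_normal_distribution borel (\<lambda>x. s * x)"
proof -
  interpret N: real_distribution std_normal_distribution by (rule real_dist_normal_dist)
  show ?thesis
  proof (cases "s = 0")
    case True
    then show ?thesis by (simp add: centred_gaussian_def N.distr_const)
  next
    case False
    have "distributed std_normal_distribution lborel (\<lambda>x. x) (\<lambda>x. ennreal (std_normal_density x))"
      by (auto simp: distributed_def intro!: distr_id2)
    from N.normal_density_affine[OF this, of s 0] assms False
    have "distr std_normal_distribution lborel (\<lambda>x. s * x) = density lborel (\<lambda>x. ennreal (normal_density 0 s x))"
      by (simp add: distributed_def)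
    then show ?thesis
      using False by (simp add: centred_gaussian_def cong: distr_cong)
  qed
qed

lemma centred_gaussian_facts:
  assumes "s \<ge> 0"
  shows prob_space_centred_gaussian: "prob_space (centred_gaussian s)"
    and sets_centred_gaussian: "sets (centred_gaussian s) = sets borel"
    and char_centred_gaussian: "char (centred_gaussian s) t = exp (- ((s * t)\<^sup>2 / 2))"
    and integrable_centred_gaussian_abs_power: "integrable (centred_gaussian s) (\<lambda>y. \<bar>y\<bar> ^ k)"
    and integral_centred_gaussian: "(\<integral>y. y \<partial>centred_gaussian s) = 0"
    and integral_centred_gaussian_square: "(\<integral>y. y\<^sup>2 \<partial>centred_gaussian s) = s\<^sup>2"
    and integral_centred_gaussian_cube: "(\<integral>y. \<bar>y\<bar> ^ 3 \<partial>centred_gaussian s) \<le> 2 * s ^ 3"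
proof -
  note eq = centred_gaussian_eq_distr[OF assms]
  interpret N: real_distribution std_normal_distribution by (rule real_dist_normal_dist)
  show "prob_space (centred_gaussian s)" unfolding eq by (rule N.prob_space_distr) simp
  show "sets (centred_gaussian s) = sets borel" by (simp add: eq)
  have "char (centred_gaussian s) t = char std_normal_distribution (s * t)"
    unfolding eq char_def by (subst integral_distr) (simp_all add: mult_ac)
  then show "char (centred_gaussian s) t = exp (- ((s * t)\<^sup>2 / 2))"
    by (simp add: char_std_normal_distribution)
  have "integrable std_normal_distribution (\<lambda>y. s ^ k * \<bar>y ^ k\<bar>)"
    by (intro integrable_mult_right integrable_abs integrable_std_normal_distribution_moment)
  then show "integrable (centred_gaussian s) (\<lambda>y. \<bar>y\<bar> ^ k)"
    unfolding eq using assms by (subst integrable_distr_eq) (auto simp: abs_mult power_mult_distrib power_abs)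
  show "(\<integral>y. y \<partial>centred_gaussian s) = 0"
    unfolding eq using integral_std_normal_distribution_moment_odd[of 1]
    by (subst integral_distr) auto
  show "(\<integral>y. y\<^sup>2 \<partial>centred_gaussian s) = s\<^sup>2"
    unfolding eq using std_normal_distribution_even_moments[of 1]
    by (subst integral_distr) (auto simp: power_mult_distrib)
  \<comment> \<open>The third absolute moment of a standard normal variable is 2 * sqrt (2 / pi);
    the bound 2 suffices.\<close>
  have "sqrt (2 / pi) \<le> 1" using pi_gt3 by simp
  then have "(\<integral>y. \<bar>y\<bar> ^ 3 \<partial>std_normal_distribution) \<le> 2"
    using std_normal_distribution_odd_moments_abs[of 1] by (simp add: numeral_3_eq_3)
  then have "s ^ 3 * (\<integral>y. \<bar>y\<bar> ^ 3 \<partial>std_normal_distribution) \<le> s ^ 3 * 2"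
    using assms by (intro mult_left_mono) auto
  then show "(\<integral>y. \<bar>y\<bar> ^ 3 \<partial>centred_gaussian s) \<le> 2 * s ^ 3"
    unfolding eq using assms by (subst integral_distr) (auto simp: abs_mult power_mult_distrib)
qed

text \<open>The definition provides some standard deviation for each linear combination; the second
  moment, computed from the covariances, determines it.\<close>

lemma jointly_centred_gaussian_orthogonal:
  assumes "prob_space M" and J: "finite J" and Z: "jointly_centred_gaussian M J Z"
    and cov: "\<And>k l. k \<in> J \<Longrightarrow> l \<in> J \<Longrightarrow> (\<integral>\<omega>. Z k \<omega> * Z l \<omega> \<partial>M) = (if k = l then v else 0)"
  shows "distr M borel (\<lambda>\<omega>. \<Sum>k\<in>J. a k * Z k \<omega>) = centred_gaussian (sqrt (v * (\<Sum>k\<in>J. (a k)\<^sup>2)))"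
proof -
  interpret prob_space M by fact
  have Z_meas[measurable]: "Z k \<in> borel_measurable M" if "k \<in> J" for k
    using Z that by (simp add: jointly_centred_gaussian_def)
  have sum_meas[measurable]: "(\<lambda>\<omega>. \<Sum>k\<in>J. a k * Z k \<omega>) \<in> borel_measurable M" for a
    by measurable
  have law: "\<exists>s\<ge>0. distr M borel (\<lambda>\<omega>. \<Sum>k\<in>J. a k * Z k \<omega>) = centred_gaussian s" for a
    using Z by (auto simp: jointly_centred_gaussian_def)
  \<comment> \<open>The covariance identities alone do not give integrability, since the integral of
    a nonintegrable function is 0 by convention. It comes from the Gaussian law of the combination
    with a single nonzero weight.\<close>
  have square: "integrable M (\<lambda>\<omega>. (Z k \<omega>)\<^sup>2)" if k: "k \<in> J" for k
  proof -
    have *: "(\<lambda>\<omega>. \<Sum>l\<in>J. (if l = k then 1 else 0) * Z l \<omega>) = Z k"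
      using J k by (simp add: if_distrib[of "\<lambda>x. x * _"] fun_eq_iff cong: if_cong)
    from law[of "\<lambda>l. if l = k then 1 else 0"] obtain s
      where "s \<ge> 0" "distr M borel (Z k) = centred_gaussian s"
      unfolding * by blast
    then have "integrable (distr M borel (Z k)) (\<lambda>y. y\<^sup>2)"
      using integrable_centred_gaussian_abs_power[of s 2] by simp
    then show ?thesis by (rule integrable_distr[OF Z_meas[OF k]])
  qed
  have prod: "integrable M (\<lambda>\<omega>. Z k \<omega> * Z l \<omega>)" if "k \<in> J" "l \<in> J" for k l
  proof (rule Bochner_Integration.integrable_bound)
    show "integrable M (\<lambda>\<omega>. (Z k \<omega>)\<^sup>2 + (Z l \<omega>)\<^sup>2)" using square that by simp
    have "\<bar>x * y\<bar> \<le> x\<^sup>2 + y\<^sup>2" for x y :: real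
    proof -
      have "0 \<le> (\<bar>x\<bar> - \<bar>y\<bar>)\<^sup>2" by simp
      then have "2 * \<bar>x * y\<bar> \<le> x\<^sup>2 + y\<^sup>2" by (simp add: power2_diff abs_mult)
      then show ?thesis by linarith
    qed
    then show "AE \<omega> in M. norm (Z k \<omega> * Z l \<omega>) \<le> norm ((Z k \<omega>)\<^sup>2 + (Z l \<omega>)\<^sup>2)"
      by simp
  qed (use that in measurable)
  obtain s where s: "s \<ge> 0" "distr M borel (\<lambda>\<omega>. \<Sum>k\<in>J. a k * Z k \<omega>) = centred_gaussian s"
    using law by blast
  have "s\<^sup>2 = (\<integral>\<omega>. (\<Sum>k\<in>J. a k * Z k \<omega>)\<^sup>2 \<partial>M)"
    using integral_centred_gaussian_square[OF s(1)] unfolding s(2)[symmetric]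
    by (subst (asm) integral_distr) simp_all
  also have "\<dots> = (\<integral>\<omega>. (\<Sum>k\<in>J. \<Sum>l\<in>J. a k * a l * (Z k \<omega> * Z l \<omega>)) \<partial>M)"
    by (simp add: power2_eq_square sum_product mult_ac)
  also have "\<dots> = (\<Sum>k\<in>J. \<Sum>l\<in>J. a k * a l * (if k = l then v else 0))"
    using prod cov by (subst Bochner_Integration.integral_sum) (auto intro!: sum.cong simp: Bochner_Integration.integral_sum)
  also have "\<dots> = v * (\<Sum>k\<in>J. (a k)\<^sup>2)"
    using J by (simp add: sum_distrib_left power2_eq_square mult_ac if_distrib[of "\<lambda>x. _ * x"] cong: if_cong)
  finally have "s = sqrt (v * (\<Sum>k\<in>J. (a k)\<^sup>2))"
    using s(1) by (metis real_sqrt_unique)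
  with s(2) show ?thesis by simp
qed


section \<open>The two processes\<close>

lemma finite_edges: "finite (edges n)"
  by (rule finite_subset[of _ "{1..n} \<times> {1..n}"]) (auto simp: edges_def)

text \<open>The square splits into the diagonal, the pairs above it and their mirror images.\<close>

lemma sum_square_eq_sum_edges:
  fixes f :: "nat \<times> nat \<Rightarrow> 'a::comm_monoid_add"
  assumes "\<And>i. i \<in> {1..n} \<Longrightarrow> f (i, i) = 0"
  shows "(\<Sum>i = 1..n. \<Sum>j = 1..n. f (i, j)) = (\<Sum>e\<in>edges n. f e + f (prod.swap e))"
proof -
  define S where "S = {1..n} \<times> {1..n}"
  have "(\<Sum>i = 1..n. \<Sum>j = 1..n. f (i, j)) = (\<Sum>e\<in>S. f e)"
    by (simp add: S_def sum.cartesian_product)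
  also have "\<dots> = (\<Sum>e\<in>edges n \<union> prod.swap ` edges n. f e)"
  proof (rule sum.mono_neutral_right)
    show "finite S" by (simp add: S_def)
    show "\<forall>e\<in>S - (edges n \<union> prod.swap ` edges n). f e = 0"
    proof
      fix e assume e: "e \<in> S - (edges n \<union> prod.swap ` edges n)"
      obtain i j where ij: "e = (i, j)" by fastforce
      have "(i, j) = prod.swap (j, i)" by simp
      then have "\<not> j < i" using e unfolding ij by (force simp: S_def edges_def)
      moreover have "\<not> i < j" using e unfolding ij by (auto simp: S_def edges_def)
      ultimately show "f e = 0" using e assms by (auto simp: ij S_def)
    qed
  qed (auto simp: edges_def S_def)
  also have "\<dots> = (\<Sum>e\<in>edges n. f e) + (\<Sum>e\<in>prod.swap ` edges n. f e)"
    by (rule sum.union_disjoint) (use finite_edges in \<open>simp_all\<close>, auto simp: edges_def)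
  also have "(\<Sum>e\<in>prod.swap ` edges n. f e) = (\<Sum>e\<in>edges n. f (prod.swap e))"
    by (subst sum.reindex) (auto simp: inj_on_def comp_def)
  finally show ?thesis by (simp add: sum.distrib)
qed

lemma card_edges_le: "2 * card (edges n) \<le> n\<^sup>2"
proof -
  have "2 * card (edges n) = (\<Sum>e\<in>edges n. 1 + 1)" by simp
  \<comment> \<open>Twice the number of edges is the sum over the square of the indicator of being
    off the diagonal.\<close>
  also have "\<dots> = (\<Sum>e\<in>edges n. (if fst e = snd e then 0 else 1) + (if fst (prod.swap e) = snd (prod.swap e) then 0 else 1))"
    by (intro sum.cong) (auto simp: edges_def)
  also have "\<dots> = (\<Sum>i = 1..n. \<Sum>j = 1..n. if i = j then 0 else 1)"
    using sum_square_eq_sum_edges[of n "\<lambda>e. if fst e = snd e then 0 else 1 :: nat"] by simp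
  also have "\<dots> \<le> (\<Sum>i = 1..n. \<Sum>j = 1..n. 1)" by (intro sum_mono) simp
  finally show ?thesis by (simp add: power2_eq_square)
qed

text \<open>An edge lies among the first \<lfloor>nt\<rfloor> vertices as soon as its larger
  endpoint does, so the switch looks at \<open>snd e\<close> only.\<close>

definition edge_path :: "nat \<Rightarrow> nat \<times> nat \<Rightarrow> skorokhod" where
  "edge_path n e = to_skorokhod (\<lambda>t.
    if snd e \<le> nat \<lfloor>real n * t\<rfloor> then (of_int \<lfloor>real n * t\<rfloor> - 2) / real n ^ 2 else 0)"

lemma path_edge_path:
  assumes "t \<in> {0..1}"
  shows "path (edge_path n e) t =
    (if snd e \<le> nat \<lfloor>real n * t\<rfloor> then (of_int \<lfloor>real n * t\<rfloor> - 2) / real n ^ 2 else 0)"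
proof -
  have "cadlag01 (\<lambda>t. if snd e \<le> nat \<lfloor>real n * t\<rfloor> then (of_int \<lfloor>real n * t\<rfloor> - 2) / real n ^ 2 else 0)"
    by (rule cadlag01_floor[where F = "\<lambda>m. if snd e \<le> nat m then (of_int m - 2) / real n ^ 2 else 0"])
  then show ?thesis using assms by (simp add: edge_path_def path_to_skorokhod)
qed

lemma nat_floor_mult:
  assumes "t \<in> {0..1}"
  shows "nat \<lfloor>real n * t\<rfloor> \<le> n" and "of_int \<lfloor>real n * t\<rfloor> = real (nat \<lfloor>real n * t\<rfloor>)"
proof -
  have "real n * t \<le> real n * 1" using assms by (intro mult_left_mono) auto
  then show "nat \<lfloor>real n * t\<rfloor> \<le> n" by linarith
  have "0 \<le> real n * t" using assms by simp
  then have "0 \<le> \<lfloor>real n * t\<rfloor>" by linarith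
  then show "of_int \<lfloor>real n * t\<rfloor> = real (nat \<lfloor>real n * t\<rfloor>)" by simp
qed

lemma norm_edge_path_le:
  assumes "e \<in> edges n"
  shows "norm (edge_path n e) \<le> 1 / real n"
proof (rule norm_skorokhod_le)
  fix t :: real assume t: "t \<in> {0..1}"
  define m where "m = nat \<lfloor>real n * t\<rfloor>"
  show "\<bar>path (edge_path n e) t\<bar> \<le> 1 / real n"
  proof (cases "snd e \<le> m")
    case True
    then have "2 \<le> m" "m \<le> n"
      using assms nat_floor_mult(1)[OF t] by (auto simp: m_def edges_def)
    then have "\<bar>(real m - 2) / real n ^ 2\<bar> \<le> real n / real n ^ 2"
      by (auto intro: divide_right_mono)
    also have "\<dots> = 1 / real n" by (simp add: power2_eq_square)
    finally show ?thesis
      using True by (simp add: path_edge_path[OF t] nat_floor_mult(2)[OF t] flip: m_def)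
  qed (simp add: path_edge_path[OF t] flip: m_def)
qed

lemma path_sum: "path (\<Sum>e\<in>E. w e) t = (\<Sum>e\<in>E. path (w e) t)"
  by (induction E rule: infinite_finite_induct) (simp_all add: path_zero path_add)

lemma path_sum_edge_path:
  assumes t: "t \<in> {0..1}"
  shows "path (\<Sum>e\<in>edges n. c e *\<^sub>R edge_path n e) t =
    (of_int \<lfloor>real n * t\<rfloor> - 2) / real n ^ 2 * (\<Sum>e\<in>edges (nat \<lfloor>real n * t\<rfloor>). c e)"
proof -
  define m where "m = nat \<lfloor>real n * t\<rfloor>"
  have "m \<le> n" using nat_floor_mult(1)[OF t] by (simp add: m_def)
  then have m: "edges m = {e \<in> edges n. snd e \<le> m}" by (auto simp: edges_def)
  have "path (\<Sum>e\<in>edges n. c e *\<^sub>R edge_path n e) t =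
    (\<Sum>e\<in>edges n. if snd e \<le> m then c e * ((of_int \<lfloor>real n * t\<rfloor> - 2) / real n ^ 2) else 0)"
    by (auto simp: path_sum path_scaleR path_edge_path[OF t] intro!: sum.cong simp flip: m_def)
  also have "\<dots> = (\<Sum>e\<in>edges m. c e * ((of_int \<lfloor>real n * t\<rfloor> - 2) / real n ^ 2))"
    unfolding m by (rule sum.inter_filter[symmetric]) (rule finite_edges)
  also have "\<dots> = (of_int \<lfloor>real n * t\<rfloor> - 2) / real n ^ 2 * (\<Sum>e\<in>edges m. c e)"
    by (subst sum_distrib_right[symmetric]) (rule mult.commute)
  finally show ?thesis by (simp add: m_def)
qed

text \<open>The weight \<open>real n ^ 2\<close> undoes the division built into
  \<open>edge_path\<close>, so that the Gaussian coefficients acquire the scale of the centred edge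
  indicators.\<close>

lemma D_proc_eq_sum:
  assumes "n > 0" and diag: "\<And>i. i \<in> {1..n} \<Longrightarrow> Z (i, i) \<omega> = 0"
  shows "D_proc n Z \<omega> = (\<Sum>e\<in>edges n. (real n ^ 2 * (Z e \<omega> + Z (prod.swap e) \<omega>)) *\<^sub>R edge_path n e)"
proof (rule skorokhod_eqI)
  fix t :: real assume t: "t \<in> {0..1}"
  define m where "m = nat \<lfloor>real n * t\<rfloor>"
  have "m \<le> n" using nat_floor_mult(1)[OF t] by (simp add: m_def)
  then have "(\<Sum>i = 1..m. \<Sum>j = 1..m. Z (i, j) \<omega>) = (\<Sum>e\<in>edges m. Z e \<omega> + Z (prod.swap e) \<omega>)"
    using diag by (intro sum_square_eq_sum_edges[where f = "\<lambda>k. Z k \<omega>"]) auto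
  then show "path (D_proc n Z \<omega>) t =
      path (\<Sum>e\<in>edges n. (real n ^ 2 * (Z e \<omega> + Z (prod.swap e) \<omega>)) *\<^sub>R edge_path n e) t"
    unfolding path_D_proc[OF t] path_sum_edge_path[OF t] m_def[symmetric]
    using \<open>n > 0\<close> by (simp flip: sum_distrib_left)
qed

lemma Y_proc_eq_sum:
  assumes I: "\<And>e. e \<in> edges n \<Longrightarrow> integrable P (I e)" "\<And>e. e \<in> edges n \<Longrightarrow> (\<integral>\<omega>. I e \<omega> \<partial>P) = p"
  shows "Y_proc P n I \<omega> = (\<Sum>e\<in>edges n. (I e \<omega> - p) *\<^sub>R edge_path n e)"
proof (rule skorokhod_eqI)
  fix t :: real assume t: "t \<in> {0..1}"
  define m where "m = nat \<lfloor>real n * t\<rfloor>"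
  have "m \<le> n" using nat_floor_mult(1)[OF t] by (simp add: m_def)
  then have "edges m \<subseteq> edges n" by (auto simp: edges_def)
  then have I_m: "integrable P (I e)" "(\<integral>\<omega>. I e \<omega> \<partial>P) = p" if "e \<in> edges m" for e
    using I that by blast+
  have "(\<integral>\<omega>. (\<Sum>e\<in>edges m. I e \<omega>) \<partial>P) = (\<Sum>e\<in>edges m. \<integral>\<omega>. I e \<omega> \<partial>P)"
    by (rule Bochner_Integration.integral_sum) (rule I_m)
  also have "\<dots> = (\<Sum>e\<in>edges m. p)" by (rule sum.cong[OF refl]) (rule I_m)
  finally show "path (Y_proc P n I \<omega>) t = path (\<Sum>e\<in>edges n. (I e \<omega> - p) *\<^sub>R edge_path n e) t"
    unfolding path_Y_proc[OF t] path_sum_edge_path[OF t] T_proc_def m_def[symmetric]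
    by (simp add: sum_subtractf right_diff_distrib)
qed

lemma bernoulli_rv_integral:
  fixes h :: "real \<Rightarrow> real"
  assumes "bernoulli_rv P p X" "0 \<le> p" "p \<le> 1" and [measurable]: "h \<in> borel_measurable borel"
  shows "integrable P (\<lambda>\<omega>. h (X \<omega>))" and "(\<integral>\<omega>. h (X \<omega>) \<partial>P) = h 1 * p + h 0 * (1 - p)"
proof -
  have X[measurable]: "X \<in> borel_measurable P" and D: "distr P borel X = distr (bernoulli_pmf p) borel of_bool"
    using assms by (auto simp: bernoulli_rv_def)
  have "integrable (distr P borel X) h"
    unfolding D by (subst integrable_distr_eq) (auto intro!: integrable_measure_pmf_finite)
  then show "integrable P (\<lambda>\<omega>. h (X \<omega>))" by (rule integrable_distr[OF X])
  have "(\<integral>\<omega>. h (X \<omega>) \<partial>P) = (\<integral>x. h x \<partial>distr P borel X)" by (rule integral_distr[symmetric]) measurable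
  also have "\<dots> = h 1 * p + h 0 * (1 - p)"
    unfolding D using assms by (subst integral_distr) auto
  finally show "(\<integral>\<omega>. h (X \<omega>) \<partial>P) = h 1 * p + h 0 * (1 - p)" .
qed

definition centred_bernoulli :: "real \<Rightarrow> real measure" where
  "centred_bernoulli p = distr (bernoulli_pmf p) borel (\<lambda>b. of_bool b - p)"

lemma centred_bernoulli_facts:
  assumes "0 \<le> p" "p \<le> 1"
  shows prob_space_centred_bernoulli: "prob_space (centred_bernoulli p)"
    and sets_centred_bernoulli: "sets (centred_bernoulli p) = sets borel"
    and integrable_centred_bernoulli: "integrable (centred_bernoulli p) (\<lambda>y. \<bar>y\<bar> ^ k)"
    and integral_centred_bernoulli: "(\<integral>y. y \<partial>centred_bernoulli p) = 0"
    and integral_centred_bernoulli_square: "(\<integral>y. y\<^sup>2 \<partial>centred_bernoulli p) = p * (1 - p)"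
    and integral_centred_bernoulli_cube: "(\<integral>y. \<bar>y\<bar> ^ 3 \<partial>centred_bernoulli p) \<le> p * (1 - p)"
proof -
  have h: "integrable (centred_bernoulli p) h"
    "(\<integral>y. h y \<partial>centred_bernoulli p) = h (1 - p) * p + h (- p) * (1 - p)"
    if [measurable]: "h \<in> borel_measurable borel" for h :: "real \<Rightarrow> real"
    using assms by (simp_all add: centred_bernoulli_def integrable_distr_eq integral_distr integrable_measure_pmf_finite)
  show "prob_space (centred_bernoulli p)"
    unfolding centred_bernoulli_def by (rule measure_pmf.prob_space_distr) simp
  show "sets (centred_bernoulli p) = sets borel" by (simp add: centred_bernoulli_def)
  show "integrable (centred_bernoulli p) (\<lambda>y. \<bar>y\<bar> ^ k)" by (rule h) simp
  show "(\<integral>y. y \<partial>centred_bernoulli p) = 0" by (subst h) (simp_all add: algebra_simps)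
  show sq: "(\<integral>y. y\<^sup>2 \<partial>centred_bernoulli p) = p * (1 - p)"
    by (subst h) (simp_all add: power2_eq_square algebra_simps)
  have "(\<integral>y. \<bar>y\<bar> ^ 3 \<partial>centred_bernoulli p) = \<bar>1 - p\<bar> ^ 3 * p + \<bar>- p\<bar> ^ 3 * (1 - p)"
    by (subst h) simp_all
  \<comment> \<open>Both values have modulus at most 1, so the cube is at most the square and the
    third moment at most the variance.\<close>
  also have "\<dots> \<le> (1 - p)\<^sup>2 * p + p\<^sup>2 * (1 - p)"
    using assms by (intro add_mono mult_right_mono) (auto intro!: power_decreasing)
  also have "\<dots> = p * (1 - p)" by (simp add: power2_eq_square algebra_simps)
  finally show "(\<integral>y. \<bar>y\<bar> ^ 3 \<partial>centred_bernoulli p) \<le> p * (1 - p)" .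
qed

lemma distr_centred_bernoulli:
  assumes "bernoulli_rv P p X"
  shows "distr P borel (\<lambda>\<omega>. X \<omega> - p) = centred_bernoulli p"
proof -
  have [measurable]: "X \<in> borel_measurable P" and D: "distr P borel X = distr (bernoulli_pmf p) borel of_bool"
    using assms by (auto simp: bernoulli_rv_def)
  have "distr P borel (\<lambda>\<omega>. X \<omega> - p) = distr (distr P borel X) borel (\<lambda>x. x - p)"
    by (subst distr_distr) (simp_all add: comp_def)
  then show ?thesis
    unfolding D centred_bernoulli_def by (subst (asm) distr_distr) (simp_all add: comp_def)
qed

lemma (in prob_space) distr_eq_PiM_if_indep_vars:
  assumes "finite E" and "indep_vars (\<lambda>_. borel) X E"
  shows "distr M (PiM E (\<lambda>_. borel)) (\<lambda>\<omega>. \<lambda>e\<in>E. X e \<omega> :: real) = PiM E (\<lambda>e. distr M borel (X e))"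
proof (cases "E = {}")
  \<comment> \<open>This case does occur: for \<open>n = 1\<close> there are no edges.\<close>
  case True
  then show ?thesis by (intro distr_eq_PiM_if_char_factor) (simp_all add: prob_space)
next
  case False
  have "random_variable borel (X e)" if "e \<in> E" for e
    using assms(2) that by (simp add: indep_vars_def)
  with indep_vars_iff_distr_eq_PiM'[OF False, where M' = "\<lambda>_. borel" and X = X] assms(2) show ?thesis by blast
qed

lemma distr_centred_edges:
  assumes "prob_space P" and I: "\<And>e. e \<in> edges n \<Longrightarrow> bernoulli_rv P p (I e)"
    and indep: "prob_space.indep_vars P (\<lambda>_. borel) I (edges n)"
  shows "distr P (PiM (edges n) (\<lambda>_. borel)) (\<lambda>\<omega>. \<lambda>e\<in>edges n. I e \<omega> - p) =
    PiM (edges n) (\<lambda>_. centred_bernoulli p)"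
proof -
  interpret prob_space P by fact
  have "indep_vars (\<lambda>_. borel) (\<lambda>e \<omega>. I e \<omega> - p) (edges n)"
    by (rule indep_vars_compose2[OF indep, of "\<lambda>_ x. x - p"]) simp
  then have "distr P (PiM (edges n) (\<lambda>_. borel)) (\<lambda>\<omega>. \<lambda>e\<in>edges n. I e \<omega> - p) =
    PiM (edges n) (\<lambda>e. distr P borel (\<lambda>\<omega>. I e \<omega> - p))"
    by (rule distr_eq_PiM_if_indep_vars[OF finite_edges])
  also have "\<dots> = PiM (edges n) (\<lambda>_. centred_bernoulli p)"
    by (intro PiM_cong refl distr_centred_bernoulli I)
  finally show ?thesis .
qed

text \<open>A combination of the \<open>G e\<close> with weights \<open>b\<close> is centred
  Gaussian with variance \<open>q\<close> times the sum of the squared weights. Its characteristic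
  function is therefore a product over the edges, which gives independence.\<close>

lemma distr_symmetrized_gaussian:
  fixes n :: nat and Z :: "nat \<times> nat \<Rightarrow> 'b \<Rightarrow> real"
  defines "J \<equiv> {(i, j). i \<in> {1..n} \<and> j \<in> {1..n} \<and> i \<noteq> j}"
    and "G \<equiv> \<lambda>e \<omega>. real n ^ 2 * (Z e \<omega> + Z (prod.swap e) \<omega>)"
  assumes n: "n > 0" and "prob_space Q" and Z: "jointly_centred_gaussian Q J Z" and q: "q \<ge> 0"
    and cov: "\<And>k l. k \<in> J \<Longrightarrow> l \<in> J \<Longrightarrow>
      (\<integral>\<omega>. Z k \<omega> * Z l \<omega> \<partial>Q) = (if k = l then q / (2 * real n ^ 4) else 0)"
  shows "distr Q (PiM (edges n) (\<lambda>_. borel)) (\<lambda>\<omega>. \<lambda>e\<in>edges n. G e \<omega>) =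
    PiM (edges n) (\<lambda>_. centred_gaussian (sqrt q))"
proof -
  interpret prob_space Q by fact
  have J: "finite J" "J \<subseteq> {1..n} \<times> {1..n}"
    by (rule finite_subset[of _ "{1..n} \<times> {1..n}"]) (auto simp: J_def)
  have sum_J: "(\<Sum>k\<in>J. h k) = (\<Sum>e\<in>edges n. h e + h (prod.swap e))" for h :: "nat \<times> nat \<Rightarrow> real"
  proof -
    have "(\<Sum>k\<in>J. h k) = (\<Sum>k\<in>J. if fst k = snd k then 0 else h k)"
      by (intro sum.cong) (auto simp: J_def)
    also have "\<dots> = (\<Sum>k\<in>{1..n} \<times> {1..n}. if fst k = snd k then 0 else h k)"
      using J by (intro sum.mono_neutral_left) (auto simp: J_def)
    also have "\<dots> = (\<Sum>i = 1..n. \<Sum>j = 1..n. if fst (i, j) = snd (i, j) then 0 else h (i, j))"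
      by (subst sum.cartesian_product) (auto intro!: sum.cong)
    also have "\<dots> = (\<Sum>e\<in>edges n. (if fst e = snd e then 0 else h e) +
        (if fst (prod.swap e) = snd (prod.swap e) then 0 else h (prod.swap e)))"
      by (rule sum_square_eq_sum_edges) simp
    also have "\<dots> = (\<Sum>e\<in>edges n. h e + h (prod.swap e))"
      by (intro sum.cong) (auto simp: edges_def)
    finally show ?thesis .
  qed
  have edges_J: "e \<in> J" "prod.swap e \<in> J" if "e \<in> edges n" for e
    using that by (auto simp: J_def edges_def)
  have G_meas: "G e \<in> borel_measurable Q" if "e \<in> edges n" for e
    using Z edges_J[OF that] unfolding G_def
    by (intro borel_measurable_times borel_measurable_add borel_measurable_const)
      (auto simp: jointly_centred_gaussian_def)
  have law: "distr Q borel (\<lambda>\<omega>. \<Sum>e\<in>edges n. b e * G e \<omega>) =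
      centred_gaussian (sqrt (q * (\<Sum>e\<in>edges n. (b e)\<^sup>2)))" for b
  proof -
    \<comment> \<open>Edge weights are carried over symmetrically to ordered pairs. Each edge then
      counts twice, which cancels the 2 in the covariance, while the squared factor n^2 cancels
      n^4.\<close>
    define a where "a = (\<lambda>k. real n ^ 2 * b (if fst k < snd k then k else prod.swap k))"
    have a: "a e = real n ^ 2 * b e" "a (prod.swap e) = real n ^ 2 * b e" if "e \<in> edges n" for e
      using that by (auto simp: a_def edges_def)
    have "(\<lambda>\<omega>. \<Sum>e\<in>edges n. b e * G e \<omega>) = (\<lambda>\<omega>. \<Sum>k\<in>J. a k * Z k \<omega>)"
      unfolding sum_J by (intro ext sum.cong) (auto simp: a G_def algebra_simps)
    moreover have "(\<Sum>k\<in>J. (a k)\<^sup>2) = 2 * real n ^ 4 * (\<Sum>e\<in>edges n. (b e)\<^sup>2)"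
      unfolding sum_J sum_distrib_left by (intro sum.cong) (auto simp: a power_mult_distrib)
    ultimately show ?thesis
      using jointly_centred_gaussian_orthogonal[OF \<open>prob_space Q\<close> J(1) Z cov, of a] n by simp
  qed
  have marginal: "distr Q borel (G e) = centred_gaussian (sqrt q)" if e: "e \<in> edges n" for e
    using law[of "\<lambda>k. if k = e then 1 else 0"] e finite_edges[of n]
    by (simp add: if_distrib[of "\<lambda>x. x * _"] if_distrib[of "\<lambda>x. x\<^sup>2"] cong: if_cong)
  have "distr Q (PiM (edges n) (\<lambda>_. borel)) (\<lambda>\<omega>. \<lambda>e\<in>edges n. G e \<omega>) = PiM (edges n) (\<lambda>e. distr Q borel (G e))"
  proof (rule distr_eq_PiM_if_char_factor[OF finite_edges G_meas])
    fix b :: "nat \<times> nat \<Rightarrow> real"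
    have [measurable]: "(\<lambda>\<omega>. \<Sum>e\<in>edges n. b e * G e \<omega>) \<in> borel_measurable Q"
      using G_meas by (intro borel_measurable_sum borel_measurable_times) auto
    have "(\<integral>\<omega>. iexp (\<Sum>e\<in>edges n. b e * G e \<omega>) \<partial>Q) =
      char (distr Q borel (\<lambda>\<omega>. \<Sum>e\<in>edges n. b e * G e \<omega>)) 1"
      unfolding char_def by (subst integral_distr) simp_all
    also have "\<dots> = exp (\<Sum>e\<in>edges n. - ((sqrt q * b e)\<^sup>2 / 2))"
    proof -
      have "0 \<le> q * (\<Sum>e\<in>edges n. (b e)\<^sup>2)" using q by (simp add: sum_nonneg)
      moreover have "(\<Sum>e\<in>edges n. - ((sqrt q * b e)\<^sup>2 / 2)) = - (q * (\<Sum>e\<in>edges n. (b e)\<^sup>2) / 2)"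
        using q by (simp add: power_mult_distrib sum_negf sum_divide_distrib sum_distrib_left)
      ultimately show ?thesis
        unfolding law by (simp only: char_centred_gaussian real_sqrt_ge_0_iff mult_1_right real_sqrt_pow2)
    qed
    also have "\<dots> = (\<Prod>e\<in>edges n. complex_of_real (exp (- ((sqrt q * b e)\<^sup>2 / 2))))"
      by (simp add: exp_sum finite_edges)
    also have "\<dots> = (\<Prod>e\<in>edges n. char (distr Q borel (G e)) (b e))"
      using q by (intro prod.cong) (simp_all add: marginal char_centred_gaussian)
    finally show "(\<integral>\<omega>. iexp (\<Sum>e\<in>edges n. b e * G e \<omega>) \<partial>Q) =
      (\<Prod>e\<in>edges n. char (distr Q borel (G e)) (b e))" .
  qed
  also have "\<dots> = PiM (edges n) (\<lambda>_. centred_gaussian (sqrt q))"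
    by (intro PiM_cong marginal refl)
  finally show ?thesis .
qed

text \<open>The passage from the sample space to the law of the coefficients; measurability is
  required only on the coefficient space, and no sigma-algebra on the paths is involved.\<close>

lemma integral_comp_sum_distr:
  fixes f :: "'b::real_normed_vector \<Rightarrow> real" and \<phi> :: "'i::countable \<Rightarrow> 'b"
  assumes f: "continuous_on UNIV f" "\<And>w. \<bar>f w\<bar> \<le> C * (1 + norm w ^ 3)" and E: "finite E"
    and X: "\<And>e. e \<in> E \<Longrightarrow> X e \<in> borel_measurable M"
    and D: "distr M (PiM E (\<lambda>_. borel)) (\<lambda>\<omega>. \<lambda>e\<in>E. X e \<omega>) = N"
  shows "(\<integral>\<omega>. f (\<Sum>e\<in>E. X e \<omega> *\<^sub>R \<phi> e) \<partial>M) = (\<integral>x. f (\<Sum>e\<in>E. x e *\<^sub>R \<phi> e) \<partial>N)"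
  unfolding D[symmetric] using X
  by (subst integral_distr)
    (auto intro!: measurable_restrict measurable_comp_sum[OF E f] cong: sum.cong)

theorem theorem6p3:
  fixes n :: nat and p :: real
    and P :: "'a measure" and I :: "nat \<times> nat \<Rightarrow> 'a \<Rightarrow> real"
    and Q :: "'b measure" and Z :: "nat \<times> nat \<Rightarrow> 'b \<Rightarrow> real"
    and g :: "skorokhod \<Rightarrow> real"
  assumes n: "n > 0" and p: "0 < p" "p < 1"
    and P: "prob_space P"
    and I_bernoulli: "\<And>i j. 1 \<le> i \<Longrightarrow> i < j \<Longrightarrow> j \<le> n \<Longrightarrow> bernoulli_rv P p (I (i, j))"
    and I_indep: "prob_space.indep_vars P (\<lambda>_. borel) I (edges n)"
    and Q: "prob_space Q"
    and Z_diag: "\<And>i \<omega>. i \<in> {1..n} \<Longrightarrow> \<omega> \<in> space Q \<Longrightarrow> Z (i, i) \<omega> = 0"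
    and Z_gauss: "jointly_centred_gaussian Q {(i, j). i \<in> {1..n} \<and> j \<in> {1..n} \<and> i \<noteq> j} Z"
    and Z_cov: "\<And>i j k l. \<lbrakk>i \<in> {1..n}; j \<in> {1..n}; k \<in> {1..n}; l \<in> {1..n}\<rbrakk> \<Longrightarrow>
      prob_space.expectation Q (\<lambda>\<omega>. Z (i, j) \<omega> * Z (k, l) \<omega>) =
        (if i = k \<and> j = l \<and> i \<noteq> j then p * (1 - p) / (2 * real n ^ 4) else 0)"
    and g: "g \<in> test_functions"
  shows "\<bar>prob_space.expectation P (\<lambda>\<omega>. g (Y_proc P n I \<omega>)) -
          prob_space.expectation Q (\<lambda>\<omega>. g (D_proc n Z \<omega>))\<bar>
         \<le> 1 / 8 * norm_M g * inverse (real n)"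
proof -
  define \<sigma> where "\<sigma> = sqrt (p * (1 - p))"
  define \<mu> where "\<mu> = centred_bernoulli p"
  define \<nu> where "\<nu> = centred_gaussian \<sigma>"
  define S where "S = (\<lambda>x. g (\<Sum>e\<in>edges n. x e *\<^sub>R edge_path n e))"
  have pq: "0 \<le> p * (1 - p)" "p * (1 - p) \<le> 1 / 4"
  proof -
    have "0 \<le> (1 - 2 * p)\<^sup>2" by simp
    then show "p * (1 - p) \<le> 1 / 4" by (simp add: power2_eq_square algebra_simps)
  qed (use p in simp)
  have \<sigma>: "0 \<le> \<sigma>" "\<sigma>\<^sup>2 = p * (1 - p)" using pq by (simp_all add: \<sigma>_def)
  have g_cont: "continuous_on UNIV g" using g by (simp add: test_functions_def)
  obtain C where C: "\<And>w. \<bar>g w\<bar> \<le> C * (1 + norm w ^ 3)" using test_functions_growth[OF g] by blast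
  have I: "bernoulli_rv P p (I e)" if "e \<in> edges n" for e
    using that I_bernoulli by (auto simp: edges_def)
  have I_measurable: "(\<lambda>\<omega>. I e \<omega> - p) \<in> borel_measurable P" if "e \<in> edges n" for e
    using I[OF that] by (intro borel_measurable_diff) (simp_all add: bernoulli_rv_def)
  have I_mean: "integrable P (I e)" "(\<integral>\<omega>. I e \<omega> \<partial>P) = p" if "e \<in> edges n" for e
    using bernoulli_rv_integral[OF I[OF that], of "\<lambda>x. x"] p by simp_all
  have Y: "Y_proc P n I \<omega> = (\<Sum>e\<in>edges n. (I e \<omega> - p) *\<^sub>R edge_path n e)" for \<omega>
    by (intro Y_proc_eq_sum I_mean)
  have EY: "(\<integral>\<omega>. g (Y_proc P n I \<omega>) \<partial>P) = (\<integral>x. S x \<partial>PiM (edges n) (\<lambda>_. \<mu>))"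
    unfolding S_def \<mu>_def Y
    by (intro integral_comp_sum_distr[OF g_cont C finite_edges] distr_centred_edges P I I_indep I_measurable)
  have ED: "(\<integral>\<omega>. g (D_proc n Z \<omega>) \<partial>Q) = (\<integral>x. S x \<partial>PiM (edges n) (\<lambda>_. \<nu>))"
  proof -
    have "(\<integral>\<omega>. g (D_proc n Z \<omega>) \<partial>Q) =
      (\<integral>\<omega>. g (\<Sum>e\<in>edges n. (real n ^ 2 * (Z e \<omega> + Z (prod.swap e) \<omega>)) *\<^sub>R edge_path n e) \<partial>Q)"
      by (intro Bochner_Integration.integral_cong refl arg_cong[of _ _ g] D_proc_eq_sum n Z_diag)
    also have "\<dots> = (\<integral>x. S x \<partial>PiM (edges n) (\<lambda>_. \<nu>))"
      unfolding S_def \<nu>_def \<sigma>_def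
    proof (intro integral_comp_sum_distr[OF g_cont C finite_edges] distr_symmetrized_gaussian n Q Z_gauss pq)
      fix e assume "e \<in> edges n"
      then show "(\<lambda>\<omega>. real n ^ 2 * (Z e \<omega> + Z (prod.swap e) \<omega>)) \<in> borel_measurable Q"
        using Z_gauss by (intro borel_measurable_times borel_measurable_add borel_measurable_const)
          (auto simp: jointly_centred_gaussian_def edges_def)
    next
      fix k l
      assume kl: "k \<in> {(i, j). i \<in> {1..n} \<and> j \<in> {1..n} \<and> i \<noteq> j}"
        "l \<in> {(i, j). i \<in> {1..n} \<and> j \<in> {1..n} \<and> i \<noteq> j}"
      obtain a b c d where eq: "k = (a, b)" "l = (c, d)" by (cases k, cases l)
      have "a \<in> {1..n}" "b \<in> {1..n}" "c \<in> {1..n}" "d \<in> {1..n}" and "a \<noteq> b"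
        using kl unfolding eq by simp_all
      then show "(\<integral>\<omega>. Z k \<omega> * Z l \<omega> \<partial>Q) = (if k = l then p * (1 - p) / (2 * real n ^ 4) else 0)"
        unfolding eq by (subst Z_cov) (simp_all only: prod.inject simp_thms)
    qed
    finally show ?thesis .
  qed
  define L where "L = norm_M g / 2"
  have L: "L \<ge> 0" using test_functions_lipschitz(2)[OF g] by (simp add: L_def)
  have third: "(\<integral>y. \<bar>y\<bar> ^ 3 \<partial>\<mu>) + (\<integral>y. \<bar>y\<bar> ^ 3 \<partial>\<nu>) \<le> 1 / 2"
  proof -
    have "(\<integral>y. \<bar>y\<bar> ^ 3 \<partial>\<mu>) \<le> 1 / 4"
      using integral_centred_bernoulli_cube[of p] p pq by (simp add: \<mu>_def)
    moreover have "\<sigma>\<^sup>2 \<le> (1 / 2)\<^sup>2"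
      unfolding \<sigma>(2) using pq(2) by (simp add: power_divide)
    then have "\<sigma> \<le> 1 / 2" by (rule power2_le_imp_le) simp
    then have "\<sigma> ^ 3 \<le> (1 / 2) ^ 3" using \<sigma>(1) by (rule power_mono)
    then have "2 * \<sigma> ^ 3 \<le> 1 / 4" by (simp add: power3_eq_cube)
    then have "(\<integral>y. \<bar>y\<bar> ^ 3 \<partial>\<nu>) \<le> 1 / 4"
      using integral_centred_gaussian_cube[OF \<sigma>(1)] by (simp add: \<nu>_def)
    ultimately show ?thesis by simp
  qed
  have "(\<Sum>e\<in>edges n. norm (edge_path n e) ^ 3) \<le> (\<Sum>e\<in>edges n. (1 / real n) ^ 3)"
    by (intro sum_mono power_mono norm_edge_path_le) auto
  also have "\<dots> = real (card (edges n)) / real n ^ 3" by (simp add: power_divide)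
  also have "\<dots> \<le> (real n ^ 2 / 2) / real n ^ 3"
  proof (rule divide_right_mono)
    have "real (2 * card (edges n)) \<le> real (n\<^sup>2)" using card_edges_le[of n] by (simp only: of_nat_le_iff)
    then show "real (card (edges n)) \<le> real n ^ 2 / 2" by simp
  qed simp
  also have "\<dots> = 1 / (2 * real n)" using n by (simp add: power2_eq_square power3_eq_cube)
  finally have paths: "(\<Sum>e\<in>edges n. norm (edge_path n e) ^ 3) \<le> 1 / (2 * real n)" .
  have "\<bar>(\<integral>x. S x \<partial>PiM (edges n) (\<lambda>_. \<mu>)) - (\<integral>x. S x \<partial>PiM (edges n) (\<lambda>_. \<nu>))\<bar> \<le>
    (\<Sum>e\<in>edges n. norm (edge_path n e) ^ 3) * (L * ((\<integral>y. \<bar>y\<bar> ^ 3 \<partial>\<mu>) + (\<integral>y. \<bar>y\<bar> ^ 3 \<partial>\<nu>)))"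
    unfolding S_def
  proof (rule lindeberg_PiM[OF finite_edges g_cont C])
    show "\<bar>g (w + y *\<^sub>R u) - (g w + y * fderiv g w u + y\<^sup>2 * (fderiv2 g w u u / 2))\<bar>
        \<le> L * norm u ^ 3 * \<bar>y\<bar> ^ 3" for w u y
      unfolding L_def using g
      by (intro taylor_second_order test_functions_lipschitz(1)[OF g]) (auto simp: test_functions_def)
    show "(\<integral>y. y \<partial>\<mu>) = (\<integral>y. y \<partial>\<nu>)"
      using p \<sigma> by (simp add: \<mu>_def \<nu>_def integral_centred_bernoulli integral_centred_gaussian)
    show "(\<integral>y. y\<^sup>2 \<partial>\<mu>) = (\<integral>y. y\<^sup>2 \<partial>\<nu>)"
      using p \<sigma> by (simp add: \<mu>_def \<nu>_def integral_centred_bernoulli_square integral_centred_gaussian_square)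
  qed (use p \<sigma> in \<open>simp_all add: \<mu>_def \<nu>_def prob_space_centred_bernoulli sets_centred_bernoulli
      integrable_centred_bernoulli prob_space_centred_gaussian sets_centred_gaussian
      integrable_centred_gaussian_abs_power\<close>)
  \<comment> \<open>The three halves forming 1/8 are the Taylor constant inside \<open>L\<close>,
    the edge count and the sum of the two third moments.\<close>
  also have "\<dots> \<le> 1 / (2 * real n) * (L * (1 / 2))"
    using third paths L by (intro mult_mono mult_left_mono mult_nonneg_nonneg add_nonneg_nonneg) auto
  also have "\<dots> = 1 / 8 * norm_M g * inverse (real n)"
    by (simp add: L_def field_simps)
  finally show ?thesis unfolding EY ED .
qed

end
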